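(* Let $\mathcal{A}$ be a Banach algebra such that $\mathrm{rad}(\mathcal{A})=\mathrm{rann}(\mathcal{A})$ and $\mathcal{A}/\mathrm{rad}(\mathcal{A})$ is commutative, and suppose $\mathcal{A}$ has a right identity. Let $d$ be a derivation of $\mathcal{A}$ and $k$ a positive integer. Then the following are equivalent: (i) $d=0$; (ii) $d$ is $k$-centralizing; (iii) $d$ is $k$-commuting.
   Context: $\mathrm{rad}(\mathcal{A})$ is the Jacobson radical and $\mathrm{rann}(\mathcal{A})=\{c\in\mathcal{A}: ac=0\ \forall a\in\mathcal{A}\}$. A derivation is a linear map $d$ with $d(ab)=d(a)b+ad(b)$. $Z(\mathcal{A})$ is the algebraic center of $\mathcal{A}$ and $[a,b]=ab-ba$. A map $T:\mathcal{A}\to\mathcal{A}$ is $k$-centralizing (resp. $k$-commuting) if $[T(a),a^k]\in Z(\mathcal{A})$ (resp. $[T(a),a^k]=0$) for all $a\in\mathcal{A}$. *)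

theory Defs
  imports "HOL-Analysis.Analysis"
begin

class complex_banach_algebra = real_normed_algebra + banach +
  fixes scaleC :: "complex \<Rightarrow> 'a \<Rightarrow> 'a"
  assumes scaleC_add_right: "scaleC c (x + y) = scaleC c x + scaleC c y"
    and scaleC_add_left: "scaleC (c + c') x = scaleC c x + scaleC c' x"
    and scaleC_scaleC: "scaleC c (scaleC c' x) = scaleC (c * c') x"
    and scaleC_one: "scaleC 1 x = x"
    and scaleR_scaleC: "scaleR r x = scaleC (complex_of_real r) x"
    and norm_scaleC: "norm (scaleC c x) = cmod c * norm x"
    and mult_scaleC_left: "scaleC c x * y = scaleC c (x * y)"
    and mult_scaleC_right: "x * scaleC c y = scaleC c (x * y)"

text \<open>Jacobson radical, via the standard characterisation for (possibly non-unital)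
algebras: x is in the radical iff a*x is quasi-invertible for every a.
Here y is a quasi-inverse of z iff z + y - z*y = 0 and z + y - y*z = 0.\<close>

definition quasi_invertible :: "'a::ring \<Rightarrow> bool" where
  "quasi_invertible z \<longleftrightarrow> (\<exists>y. z + y - z * y = 0 \<and> z + y - y * z = 0)"

definition jac_rad :: "'a::ring set" where
  "jac_rad = {x. \<forall>a. quasi_invertible (a * x)}"

definition rann :: "'a::ring set" where
  "rann = {c. \<forall>a. a * c = 0}"

definition alg_center :: "'a::ring set" where
  "alg_center = {z. \<forall>a. z * a = a * z}"

definition commutator :: "'a::ring \<Rightarrow> 'a \<Rightarrow> 'a" where
  "commutator a b = a * b - b * a"

definition derivation :: "('a::complex_banach_algebra \<Rightarrow> 'a) \<Rightarrow> bool" where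
  "derivation d \<longleftrightarrow>
     (\<forall>x y. d (x + y) = d x + d y) \<and>
     (\<forall>c x. d (scaleC c x) = scaleC c (d x)) \<and>
     (\<forall>a b. d (a * b) = d a * b + a * d b)"

text \<open>Positive powers in a possibly non-unital ring: npow a k = a^k for k >= 1
(the value for k = 0 is irrelevant and set to 0).\<close>

fun npow :: "'a::ring \<Rightarrow> nat \<Rightarrow> 'a" where
  "npow a 0 = 0"
| "npow a (Suc 0) = a"
| "npow a (Suc (Suc n)) = a * npow a (Suc n)"

definition k_centralizing :: "nat \<Rightarrow> ('a::ring \<Rightarrow> 'a) \<Rightarrow> bool" where
  "k_centralizing k T \<longleftrightarrow> (\<forall>a. commutator (T a) (npow a k) \<in> alg_center)"

definition k_commuting :: "nat \<Rightarrow> ('a::ring \<Rightarrow> 'a) \<Rightarrow> bool" where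
  "k_commuting k T \<longleftrightarrow> (\<forall>a. commutator (T a) (npow a k) = 0)"

end

theory Submission
  imports Defs "HOL-Computational_Algebra.Fundamental_Theorem_Algebra"
begin

text \<open>For a right identity \<open>e\<close>, the corner \<open>e A\<close> is a closed commutative unital subalgebra
  that complements \<open>rann A = rad A\<close>, hence it is semisimple, and \<open>x \<mapsto> e * d x\<close> is a derivation
  of it. By the theorems of Johnson and Singer-Wermer this derivation vanishes. Both are proved
  without characters: a gliding hump argument shows that the elements of the separating space
  have finite spectrum, hence are roots of polynomials with simple roots and are killed by the
  derivation; as the separating space is an ideal, its elements square to zero, so it is trivial
  and the derivation is bounded by the closed graph theorem. The Kleinecke-Shirokov argument
  then shows that its values are quasinilpotent, that is, zero. Thus \<open>d\<close> maps into \<open>rann A\<close>,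
  where centralizing and commuting coincide, and \<open>d = 0\<close> follows by testing \<open>k\<close>-commutation on
  idempotents.\<close>

section \<open>The closed graph theorem\<close>

definition linear_on :: "'a::real_vector set \<Rightarrow> ('a \<Rightarrow> 'b::real_vector) \<Rightarrow> bool" where
  "linear_on V f \<longleftrightarrow>
    (\<forall>x\<in>V. \<forall>y\<in>V. f (x + y) = f x + f y) \<and> (\<forall>c. \<forall>x\<in>V. f (c *\<^sub>R x) = c *\<^sub>R f x)"

lemma linear_on_add: "linear_on V f \<Longrightarrow> x \<in> V \<Longrightarrow> y \<in> V \<Longrightarrow> f (x + y) = f x + f y"
  and linear_on_scaleR: "linear_on V f \<Longrightarrow> x \<in> V \<Longrightarrow> f (c *\<^sub>R x) = c *\<^sub>R f x"
  by (simp_all add: linear_on_def)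

lemma linear_on_zero: "linear_on V f \<Longrightarrow> subspace V \<Longrightarrow> f 0 = 0"
  using linear_on_scaleR[of V f 0 0] by (simp add: subspace_0)

lemma linear_on_diff:
  assumes "linear_on V f" "subspace V" "x \<in> V" "y \<in> V"
  shows "f (x - y) = f x - f y"
  using linear_on_add[of V f "x - y" y] assms by (simp add: subspace_diff)

lemma linear_on_sum:
  assumes "linear_on V f" "subspace V" "\<And>i. i \<in> I \<Longrightarrow> x i \<in> V"
  shows "f (sum x I) = (\<Sum>i\<in>I. f (x i))"
  using assms(3)
  by (induction I rule: infinite_finite_induct)
    (auto simp: linear_on_zero[OF assms(1,2)] linear_on_add[OF assms(1)] subspace_sum[OF assms(2)])

locale countably_subadditive_seminorm =
  fixes V :: "'a::banach set" and p :: "'a \<Rightarrow> real"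
  assumes subspace: "subspace V" and closed: "closed V"
    and scale: "x \<in> V \<Longrightarrow> p (c *\<^sub>R x) = \<bar>c\<bar> * p x"
    and countably_subadditive:
      "(\<And>n. f n \<in> V) \<Longrightarrow> f sums s \<Longrightarrow> summable (\<lambda>n. p (f n)) \<Longrightarrow> p s \<le> (\<Sum>n. p (f n))"
begin

lemma zero: "p 0 = 0"
  using scale[of 0 0] subspace by (simp add: subspace_0)

lemma triangle:
  assumes "x \<in> V" "y \<in> V"
  shows "p (x + y) \<le> p x + p y"
proof -
  define f where "f n = (if n = 0 then x else if n = 1 then y else 0)" for n :: nat
  have "f sums (\<Sum>n\<in>{0, 1}. f n)" "(\<lambda>n. p (f n)) sums (\<Sum>n\<in>{0, 1}. p (f n))"
    by (rule sums_finite; auto simp: f_def zero)+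
  moreover have "f n \<in> V" for n
    using assms subspace by (simp add: f_def subspace_0)
  ultimately show ?thesis
    using countably_subadditive[of f "x + y"] by (simp add: sums_iff f_def)
qed

lemma triangle_diff: "x \<in> V \<Longrightarrow> y \<in> V \<Longrightarrow> p (x - y) \<le> p x + p y"
  using triangle[of x "- y"] scale[of y "- 1"] subspace by (simp add: subspace_neg)

lemma nonneg: "x \<in> V \<Longrightarrow> p x \<ge> 0"
  using triangle_diff[of x x] by (simp add: zero)

lemma ball_subset_closure_sublevel:
  obtains n :: nat and x\<^sub>0 \<epsilon>
  where "x\<^sub>0 \<in> V" "\<epsilon> > 0" "ball x\<^sub>0 \<epsilon> \<inter> V \<subseteq> closure {x \<in> V. p x \<le> n}"
proof -
  define U where "U n = closure {x \<in> V. p x \<le> real n}" for n :: nat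
  have UV: "U n \<subseteq> V" for n
    unfolding U_def using closed by (intro closure_minimal) auto
  have "\<exists>n. top_of_set V interior_of U n \<noteq> {}"
  proof (rule ccontr)
    assume "\<not> ?thesis"
    moreover have "closedin (top_of_set V) (U n)" for n
      using UV by (intro closed_subset) (simp_all add: U_def)
    ultimately have "top_of_set V interior_of \<Union>(range U) = {}"
      using completely_metrizable_space_closedin[OF completely_metrizable_space_euclidean] closed
      by (intro Baire_category_alt) auto
    moreover have "\<Union>(range U) = V"
    proof
      show "V \<subseteq> \<Union>(range U)"
      proof
        fix x assume "x \<in> V"
        moreover obtain n where "p x \<le> real n"
          using real_arch_simple by blast
        ultimately show "x \<in> \<Union>(range U)"
          using closure_subset[of "{x \<in> V. p x \<le> real n}"] by (auto simp: U_def)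
      qed
    qed (use UV in blast)
    ultimately have "V = {}"
      using interior_of_topspace[of "top_of_set V"] by simp
    then show False
      using subspace_0[OF subspace] by simp
  qed
  then obtain n x\<^sub>0 where x\<^sub>0: "x\<^sub>0 \<in> top_of_set V interior_of U n"
    by blast
  moreover have "openin (top_of_set V) (top_of_set V interior_of U n)"
    by (rule openin_interior_of)
  ultimately obtain \<epsilon> where "x\<^sub>0 \<in> V" "\<epsilon> > 0" "ball x\<^sub>0 \<epsilon> \<inter> V \<subseteq> top_of_set V interior_of U n"
    unfolding openin_contains_ball by blast
  with that interior_of_subset[of "top_of_set V" "U n"] show ?thesis
    unfolding U_def by blast
qed

lemma approximable_near_zero:
  obtains M \<epsilon> where "\<epsilon> > 0"
    "\<forall>v\<in>V. \<forall>\<eta>>0. norm v < \<epsilon> \<longrightarrow> (\<exists>y\<in>V. norm (v - y) < \<eta> \<and> p y \<le> M)"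
proof -
  obtain n :: nat and x\<^sub>0 \<epsilon> where x\<^sub>0: "x\<^sub>0 \<in> V" and \<epsilon>: "\<epsilon> > 0"
    and ball: "ball x\<^sub>0 \<epsilon> \<inter> V \<subseteq> closure {x \<in> V. p x \<le> n}"
    by (rule ball_subset_closure_sublevel)
  have "\<exists>y\<in>V. norm (v - y) < \<eta> \<and> p y \<le> 2 * real n"
    if v: "v \<in> V" "norm v < \<epsilon>" and "\<eta> > 0" for v \<eta>
  proof -
    have "x\<^sub>0 + v \<in> closure {x \<in> V. p x \<le> n}" "x\<^sub>0 \<in> closure {x \<in> V. p x \<le> n}"
      using x\<^sub>0 v \<epsilon> subspace ball by (auto simp: subset_iff dist_norm subspace_add)
    then obtain y\<^sub>1 y\<^sub>2 where y: "y\<^sub>1 \<in> V" "p y\<^sub>1 \<le> n" "dist y\<^sub>1 (x\<^sub>0 + v) < \<eta> / 2"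
        "y\<^sub>2 \<in> V" "p y\<^sub>2 \<le> n" "dist y\<^sub>2 x\<^sub>0 < \<eta> / 2"
      unfolding closure_approachable using \<open>\<eta> > 0\<close> half_gt_zero[of \<eta>] by blast
    have "v - (y\<^sub>1 - y\<^sub>2) = (y\<^sub>2 - x\<^sub>0) - (y\<^sub>1 - (x\<^sub>0 + v))"
      by simp
    then have "norm (v - (y\<^sub>1 - y\<^sub>2)) \<le> norm (y\<^sub>2 - x\<^sub>0) + norm (y\<^sub>1 - (x\<^sub>0 + v))"
      by (simp only: norm_triangle_ineq4)
    then have "norm (v - (y\<^sub>1 - y\<^sub>2)) < \<eta>"
      using y by (simp add: dist_norm)
    moreover have "p (y\<^sub>1 - y\<^sub>2) \<le> 2 * real n"
      using triangle_diff[of y\<^sub>1 y\<^sub>2] y by simp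
    ultimately show ?thesis
      using y subspace by (blast intro: subspace_diff)
  qed
  with \<epsilon> that show ?thesis by blast
qed

lemma approximable:
  obtains C where "C \<ge> 0"
    "\<forall>v\<in>V. \<forall>\<eta>>0. \<exists>y\<in>V. norm (v - y) < \<eta> \<and> p y \<le> C * norm v"
proof -
  obtain M \<epsilon> where \<epsilon>: "\<epsilon> > 0"
    and near: "\<forall>v\<in>V. \<forall>\<eta>>0. norm v < \<epsilon> \<longrightarrow> (\<exists>y\<in>V. norm (v - y) < \<eta> \<and> p y \<le> M)"
    by (rule approximable_near_zero)
  have "\<exists>y\<in>V. norm (v - y) < \<eta> \<and> p y \<le> 2 * \<bar>M\<bar> / \<epsilon> * norm v"
    if v: "v \<in> V" and \<eta>: "\<eta> > 0" for v \<eta>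
  proof (cases "v = 0")
    case True
    with v \<eta> show ?thesis by (intro bexI[of _ 0]) (simp_all add: zero)
  next
    case False
    define t where "t = \<epsilon> / (2 * norm v)"
    have t: "t > 0" "norm (t *\<^sub>R v) < \<epsilon>" "1 / t * \<bar>M\<bar> = 2 * \<bar>M\<bar> / \<epsilon> * norm v"
      using False \<epsilon> by (simp_all add: t_def)
    then obtain y where y: "y \<in> V" "norm (t *\<^sub>R v - y) < t * \<eta>" "p y \<le> M"
      using near v \<eta> subspace by (meson mult_pos_pos subspace_scale)
    have "v - (1 / t) *\<^sub>R y = (1 / t) *\<^sub>R (t *\<^sub>R v - y)"
      using t by (simp add: scaleR_diff_right)
    then have "norm (v - (1 / t) *\<^sub>R y) = norm (t *\<^sub>R v - y) / t"
      using t(1) by simp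
    then have "norm (v - (1 / t) *\<^sub>R y) < \<eta>"
      using y t(1) by (simp add: divide_less_eq mult.commute)
    moreover have "p ((1 / t) *\<^sub>R y) \<le> 1 / t * \<bar>M\<bar>"
      using y t(1) scale[of y "1 / t"] by (simp add: divide_right_mono)
    ultimately show ?thesis
      using y(1) subspace t(3) by (metis subspace_scale)
  qed
  with \<epsilon> that[of "2 * \<bar>M\<bar> / \<epsilon>"] show ?thesis by simp
qed

lemma ex_halving_remainders:
  assumes v: "v \<in> V" "v \<noteq> 0"
    and approx: "\<forall>v\<in>V. \<forall>\<eta>>0. \<exists>y\<in>V. norm (v - y) < \<eta> \<and> p y \<le> C * norm v"
  shows "\<exists>r. r 0 = v \<and> (\<forall>k. r k \<in> V \<and> norm (r k) \<le> norm v * (1 / 2) ^ k \<and>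
    p (r k - r (Suc k)) \<le> C * norm (r k))"
proof -
  define P where "P k w \<longleftrightarrow> w \<in> V \<and> norm w \<le> norm v * (1 / 2) ^ k \<and> (k = 0 \<longrightarrow> w = v)"
    for k :: nat and w
  have "\<exists>r. \<forall>k. P k (r k) \<and> p (r k - r (Suc k)) \<le> C * norm (r k)"
  proof (rule dependent_nat_choice)
    show "\<exists>w. P 0 w"
      using v by (simp add: P_def)
    fix w k assume "P k w"
    then have w: "w \<in> V"
      by (simp add: P_def)
    moreover have "norm v * (1 / 2) ^ Suc k > 0"
      using v by simp
    ultimately obtain y where "y \<in> V" "norm (w - y) < norm v * (1 / 2) ^ Suc k" "p y \<le> C * norm w"
      using approx by blast
    with w subspace show "\<exists>w'. P (Suc k) w' \<and> p (w - w') \<le> C * norm w"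
      by (intro exI[of _ "w - y"]) (simp add: P_def subspace_diff)
  qed
  then show ?thesis
    unfolding P_def by blast
qed

theorem zabreiko: "\<exists>C. \<forall>x\<in>V. p x \<le> C * norm x"
proof -
  obtain C where C: "C \<ge> 0"
    and approx: "\<forall>v\<in>V. \<forall>\<eta>>0. \<exists>y\<in>V. norm (v - y) < \<eta> \<and> p y \<le> C * norm v"
    by (rule approximable)
  have "p v \<le> 2 * C * norm v" if v: "v \<in> V" for v
  proof (cases "v = 0")
    case False
    define \<eta> where "\<eta> k = norm v * (1 / 2) ^ k" for k :: nat
    obtain r where r: "r 0 = v" "\<And>k. r k \<in> V" "\<And>k. norm (r k) \<le> \<eta> k"
      "\<And>k. p (r k - r (Suc k)) \<le> C * norm (r k)"
      unfolding \<eta>_def using ex_halving_remainders[OF v False approx] by blast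
    have "\<eta> \<longlonglongrightarrow> 0"
      unfolding \<eta>_def by (intro tendsto_mult_right_zero LIMSEQ_power_zero) simp
    then have "r \<longlonglongrightarrow> 0"
      using r(3) by (intro Lim_null_comparison[of r \<eta>]) simp_all
    then have sums: "(\<lambda>k. r k - r (Suc k)) sums v"
      using telescope_sums'[of r 0] r(1) by simp
    have bound: "p (r k - r (Suc k)) \<le> C * \<eta> k" for k
      using r(4)[of k] mult_left_mono[OF r(3)[of k] C] by simp
    have geometric: "(\<lambda>k. C * \<eta> k) sums (C * (norm v * 2))"
      using geometric_sums[of "1 / 2 :: real"] unfolding \<eta>_def by (intro sums_mult) simp
    have diff: "r k - r (Suc k) \<in> V" for k
      using r(2) subspace by (intro subspace_diff)
    have summable: "summable (\<lambda>k. p (r k - r (Suc k)))"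
      using sums_summable[OF geometric]
      by (rule summable_comparison_test') (use bound nonneg[OF diff] in simp)
    have "p v \<le> (\<Sum>k. p (r k - r (Suc k)))"
      using diff sums summable by (rule countably_subadditive)
    also have "\<dots> \<le> C * (norm v * 2)"
      using suminf_le[OF bound summable sums_summable[OF geometric]] sums_unique[OF geometric]
      by simp
    finally show ?thesis
      by (simp add: mult_ac)
  qed (simp add: zero)
  then show ?thesis by blast
qed

end

theorem closed_graph_bounded:
  fixes f :: "'a::banach \<Rightarrow> 'b::banach"
  assumes V: "subspace V" "closed V" and f: "linear_on V f"
    and graph: "\<And>x y. (\<And>n. x n \<in> V) \<Longrightarrow> x \<longlonglongrightarrow> 0 \<Longrightarrow> (\<lambda>n. f (x n)) \<longlonglongrightarrow> y \<Longrightarrow> y = 0"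
  shows "\<exists>C. \<forall>x\<in>V. norm (f x) \<le> C * norm x"
proof -
  interpret countably_subadditive_seminorm V "\<lambda>x. norm (f x)"
  proof
    fix x s assume x: "\<And>n. x n \<in> V" "x sums s" and summable: "summable (\<lambda>n. norm (f (x n)))"
    define z where "z n = s - (\<Sum>i<n. x i)" for n
    have partial: "(\<Sum>i<n. x i) \<in> V" for n
      using x(1) V(1) by (intro subspace_sum)
    then have s: "s \<in> V"
      using x(2) unfolding sums_def by (rule closed_sequentially[OF V(2)])
    have "z \<longlonglongrightarrow> s - s"
      unfolding z_def using x(2) by (intro tendsto_intros) (simp add: sums_def)
    moreover have "f (z n) = f s - (\<Sum>i<n. f (x i))" for n
      unfolding z_def using linear_on_diff[OF f V(1) s partial] linear_on_sum[OF f V(1) x(1)]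
      by simp
    then have "(\<lambda>n. f (z n)) \<longlonglongrightarrow> f s - (\<Sum>i. f (x i))"
      using summable_LIMSEQ[OF summable_norm_cancel[OF summable]] by (auto intro: tendsto_diff)
    moreover have "z n \<in> V" for n
      unfolding z_def using s partial V(1) by (intro subspace_diff)
    ultimately have "f s = (\<Sum>i. f (x i))"
      using graph[of z "f s - (\<Sum>i. f (x i))"] by simp
    then show "norm (f s) \<le> (\<Sum>n. norm (f (x n)))"
      using summable_norm[OF summable] by simp
  qed (use V in \<open>simp_all add: linear_on_scaleR[OF f]\<close>)
  show ?thesis by (rule zabreiko)
qed

section \<open>Gliding humps\<close>

lemma infdist_le_norm: "subspace W \<Longrightarrow> infdist x W \<le> norm (x::'a::real_normed_vector)"
  using infdist_le[of 0 W x] by (simp add: subspace_0)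

lemma infdist_add_le:
  fixes x y :: "'a::real_normed_vector"
  assumes W: "subspace W"
  shows "infdist (x + y) W \<le> infdist x W + infdist y W"
proof -
  have nonempty: "W \<noteq> {}"
    using subspace_0[OF W] by blast
  have "infdist (x + y) W - dist y b \<le> infdist x W" if b: "b \<in> W" for b
    unfolding infdist_notempty[OF nonempty, of x]
  proof (rule cINF_greatest[OF nonempty])
    fix a assume "a \<in> W"
    with b have "infdist (x + y) W \<le> dist (x + y) (a + b)"
      using W by (intro infdist_le subspace_add)
    also have "\<dots> \<le> dist x a + dist y b"
      by (rule dist_triangle_add)
    finally show "infdist (x + y) W - dist y b \<le> dist x a"
      by simp
  qed
  then have "infdist (x + y) W - infdist x W \<le> infdist y W"
    unfolding infdist_notempty[OF nonempty, of y] by (intro cINF_greatest[OF nonempty]) force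
  then show ?thesis by simp
qed

lemma infdist_add_subspace:
  fixes x :: "'a::real_normed_vector"
  assumes "subspace W" "w \<in> W"
  shows "infdist (x + w) W = infdist x W"
  using infdist_add_le[OF assms(1), of x w] infdist_add_le[OF assms(1), of "x + w" "- w"] assms
  by (simp add: subspace_neg)

lemma infdist_scaleR:
  fixes x :: "'a::real_normed_vector"
  assumes W: "subspace W"
  shows "infdist (c *\<^sub>R x) W = \<bar>c\<bar> * infdist x W"
proof (cases "c = 0")
  case True
  then show ?thesis by (simp add: subspace_0[OF W])
next
  case False
  have nonempty: "W \<noteq> {}"
    using subspace_0[OF W] by blast
  have scale_le: "\<bar>c\<bar> * infdist x W \<le> infdist (c *\<^sub>R x) W" if "c \<noteq> 0" for c x
    unfolding infdist_notempty[OF nonempty, of "c *\<^sub>R x"]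
  proof (rule cINF_greatest[OF nonempty])
    fix w assume "w \<in> W"
    then have "infdist x W \<le> dist x ((1 / c) *\<^sub>R w)"
      using W by (intro infdist_le subspace_scale)
    then have "\<bar>c\<bar> * infdist x W \<le> norm (c *\<^sub>R (x - (1 / c) *\<^sub>R w))"
      by (simp add: dist_norm mult_left_mono)
    also have "\<dots> = dist (c *\<^sub>R x) w"
      using that by (simp add: dist_norm scaleR_diff_right)
    finally show "\<bar>c\<bar> * infdist x W \<le> dist (c *\<^sub>R x) w" .
  qed
  have "\<bar>1 / c\<bar> * infdist (c *\<^sub>R x) W \<le> infdist x W"
    using scale_le[of "1 / c" "c *\<^sub>R x"] False by simp
  then have "infdist (c *\<^sub>R x) W \<le> \<bar>c\<bar> * infdist x W"
    using False by (simp add: field_simps)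
  with scale_le[OF False, of x] show ?thesis by simp
qed

lemma infdist_diff_le:
  fixes x y :: "'a::real_normed_vector"
  assumes "subspace W"
  shows "infdist (x - y) W \<le> infdist x W + infdist y W"
  using infdist_add_le[OF assms, of x "- y"] infdist_scaleR[OF assms, of "- 1" y] by simp

lemma bounded_linear_foldr:
  assumes "\<And>n. bounded_linear (T n)"
  shows "bounded_linear (foldr T ns)"
  using assms by (induction ns) (auto simp: id_def o_def intro: bounded_linear_compose)

lemma foldr_in:
  assumes "\<And>n x. x \<in> V \<Longrightarrow> T n x \<in> V" and "x \<in> V"
  shows "foldr T ns x \<in> V"
  using assms by (induction ns) auto

lemma ex_small_foldr_segments:
  assumes T: "\<And>n. bounded_linear (T n)" and "\<eta> > 0"
  shows "\<exists>\<delta>>0. \<forall>x. norm x < \<delta> \<longrightarrow> (\<forall>m\<le>n. norm (foldr T [m..<n] x) \<le> \<eta>)"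
proof -
  have "\<forall>\<^sub>F x in nhds 0. norm (foldr T [m..<n] x) < \<eta>" for m
  proof (rule order_tendstoD)
    interpret bounded_linear "foldr T [m..<n]"
      using T by (rule bounded_linear_foldr)
    have "((\<lambda>x. foldr T [m..<n] x) \<longlongrightarrow> foldr T [m..<n] 0) (nhds 0)"
      by (intro tendsto filterlim_ident)
    then show "((\<lambda>x. norm (foldr T [m..<n] x)) \<longlongrightarrow> 0) (nhds 0)"
      by (simp add: tendsto_norm_zero)
  qed (fact \<open>\<eta> > 0\<close>)
  then have "\<forall>\<^sub>F x in nhds 0. \<forall>m\<in>{..n}. norm (foldr T [m..<n] x) < \<eta>"
    by (intro eventually_ball_finite) auto
  then show ?thesis
    unfolding eventually_nhds_metric by (auto intro: less_imp_le)
qed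

lemma ex_backward_recursion:
  fixes T :: "nat \<Rightarrow> 'a::banach \<Rightarrow> 'a"
  assumes V: "subspace V" "closed V"
    and T: "\<And>n. bounded_linear (T n)" "\<And>n x. x \<in> V \<Longrightarrow> T n x \<in> V"
    and x: "\<And>n. x n \<in> V"
    and small: "\<And>m n. m \<le> n \<Longrightarrow> norm (foldr T [m..<n] (x n)) \<le> (1 / 2) ^ n"
  shows "\<exists>w. \<forall>m. w m \<in> V \<and> w m = x m + T m (w (Suc m)) \<and> norm (w m) \<le> 2"
proof -
  define s where "s m j = foldr T [m..<m + j] (x (m + j))" for m j
  define w where "w m = suminf (s m)" for m
  have s_le: "norm (s m j) \<le> (1 / 2) ^ j" for m j
    unfolding s_def by (rule order_trans[OF small power_decreasing]) simp_all
  have summable: "summable (s m)" for m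
    by (rule summable_comparison_test'[OF summable_geometric[of "1 / 2 :: real"]])
      (simp_all add: s_le)
  have sV: "s m j \<in> V" for m j
    unfolding s_def using T(2) x by (rule foldr_in)
  have "w m \<in> V" for m
    unfolding w_def
    by (rule closed_sequentially[OF V(2) _ summable_LIMSEQ[OF summable]])
      (intro subspace_sum[OF V(1)] sV)
  moreover have "w m = x m + T m (w (Suc m))" for m
  proof -
    have "[m..<m + Suc j] = m # [Suc m..<Suc m + j]" for j
      by (subst upt_conv_Cons) simp_all
    then have "s m (Suc j) = T m (s (Suc m) j)" for j
      by (simp add: s_def del: upt_Suc)
    then have "(\<Sum>j. s m (Suc j)) = T m (w (Suc m))"
      unfolding w_def using bounded_linear.suminf[OF T(1) summable] by simp
    then show ?thesis
      using suminf_split_head[OF summable[of m]] by (simp add: w_def s_def)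
  qed
  moreover have "norm (w m) \<le> 2" for m
    using norm_suminf_le[OF s_le[of m] summable_geometric] suminf_geometric[of "1 / 2 :: real"]
    by (simp add: w_def)
  ultimately show ?thesis by blast
qed

lemma backward_recursion_unfold:
  assumes T: "\<And>n. bounded_linear (T n)" and w: "\<And>m. w m = x m + T m (w (Suc m))"
  shows "w 0 = (\<Sum>j<n. foldr T [0..<j] (x j)) + foldr T [0..<n] (w n)"
proof (induction n)
  case (Suc n)
  interpret bounded_linear "foldr T [0..<n]"
    using T by (rule bounded_linear_foldr)
  have "foldr T [0..<n] (w n) = foldr T [0..<n] (x n) + foldr T [0..<n] (T n (w (Suc n)))"
    by (subst w) (rule add)
  with Suc show ?case by simp
qed simp

lemma ex_small_with_large_infdist:
  fixes f :: "'a::real_normed_vector \<Rightarrow> 'b::real_normed_vector"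
  assumes V: "subspace V" and f: "linear_on V f" and W: "subspace W"
    and unbounded: "\<And>C. \<exists>x\<in>V. infdist (f x) W > C * norm x" and "\<delta> > 0"
  shows "\<exists>x\<in>V. norm x < \<delta> \<and> infdist (f x) W > N"
proof -
  obtain x where x: "x \<in> V" "infdist (f x) W > 2 * \<bar>N\<bar> / \<delta> * norm x"
    using unbounded by blast
  have "x \<noteq> 0"
    using x(2) by (auto simp: linear_on_zero[OF f V] subspace_0[OF W])
  define c where "c = \<delta> / (2 * norm x)"
  have c: "c > 0" "c * (2 * \<bar>N\<bar> / \<delta> * norm x) = \<bar>N\<bar>" "norm (c *\<^sub>R x) < \<delta>"
    using \<open>x \<noteq> 0\<close> \<open>\<delta> > 0\<close> by (simp_all add: c_def)
  have "\<bar>N\<bar> < c * infdist (f x) W"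
    using mult_strict_left_mono[OF x(2) c(1)] unfolding c(2) .
  also have "\<dots> = infdist (f (c *\<^sub>R x)) W"
    using c(1) x(1) by (simp add: linear_on_scaleR[OF f] infdist_scaleR[OF W])
  finally have "N < infdist (f (c *\<^sub>R x)) W"
    by simp
  with c(3) x(1) V show ?thesis
    by (intro bexI[of _ "c *\<^sub>R x"]) (auto simp: subspace_scale)
qed

context
  fixes V :: "'a::banach set" and T :: "nat \<Rightarrow> 'a \<Rightarrow> 'a"
    and S :: "'a \<Rightarrow> 'b::real_normed_vector" and W :: "nat \<Rightarrow> 'b set"
  assumes V: "subspace V" "closed V"
    and T: "\<And>n. bounded_linear (T n)" "\<And>n x. x \<in> V \<Longrightarrow> T n x \<in> V"
    and S: "linear_on V S" and W: "\<And>n. subspace (W n)"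
begin

lemma linear_on_comp_foldr: "linear_on V (\<lambda>x. S (foldr T ns x))"
proof -
  interpret bounded_linear "foldr T ns"
    using T(1) by (rule bounded_linear_foldr)
  show ?thesis
    using foldr_in[of V T, OF T(2)] S by (simp add: linear_on_def add scaleR)
qed

lemma ex_hump_sequence:
  assumes unbounded: "\<And>n C. \<exists>x\<in>V. infdist (S (foldr T [0..<n] x)) (W n) > C * norm x"
  shows "\<exists>x. \<forall>n. x n \<in> V \<and> (\<forall>m\<le>n. norm (foldr T [m..<n] (x n)) \<le> (1 / 2) ^ n) \<and>
    infdist (S (foldr T [0..<n] (x n))) (W n) > b n + norm (S (\<Sum>j<n. foldr T [0..<j] (x j)))"
proof -
  have "\<exists>x. x \<in> V \<and> (\<forall>m\<le>n. norm (foldr T [m..<n] x) \<le> (1 / 2) ^ n) \<and>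
      infdist (S (foldr T [0..<n] x)) (W n) > b n + norm (S z)" for n z
  proof -
    obtain \<delta> where "\<delta> > 0"
      and \<delta>: "\<And>x. norm x < \<delta> \<Longrightarrow> \<forall>m\<le>n. norm (foldr T [m..<n] x) \<le> (1 / 2) ^ n"
      using ex_small_foldr_segments[of T "(1 / 2) ^ n" n] T(1) by auto
    then show ?thesis
      using ex_small_with_large_infdist[OF V(1) linear_on_comp_foldr W unbounded] by blast
  qed
  then obtain g where g: "\<And>n z. g n z \<in> V"
    "\<And>n z. \<forall>m\<le>n. norm (foldr T [m..<n] (g n z)) \<le> (1 / 2) ^ n"
    "\<And>n z. infdist (S (foldr T [0..<n] (g n z))) (W n) > b n + norm (S z)"
    by metis
  define z where "z = rec_nat 0 (\<lambda>n z. z + foldr T [0..<n] (g n z))"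
  have "z n = (\<Sum>j<n. foldr T [0..<j] (g j (z j)))" for n
    by (induction n) (simp_all add: z_def)
  with g show ?thesis
    by (intro exI[of _ "\<lambda>n. g n (z n)"]) metis
qed

lemma infdist_hump_le:
  assumes x: "\<And>n. x n \<in> V" and w: "\<And>m. w m \<in> V" "\<And>m. w m = x m + T m (w (Suc m))"
  shows "infdist (S (foldr T [0..<n] (x n))) (W n) \<le> norm (S (w 0)) +
    norm (S (\<Sum>j<n. foldr T [0..<j] (x j))) + infdist (S (foldr T [0..<Suc n] (w (Suc n)))) (W n)"
proof -
  let ?P = "\<lambda>n. foldr T [0..<n]" and ?z = "\<Sum>j<n. foldr T [0..<j] (x j)"
  have P_in: "?P n y \<in> V" if "y \<in> V" for n y
    using T(2) that by (rule foldr_in)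
  have "?z \<in> V"
    by (intro subspace_sum[OF V(1)] P_in x)
  moreover have "w 0 = ?z + ?P n (x n) + ?P (Suc n) (w (Suc n))"
    using backward_recursion_unfold[of T w x "Suc n", OF T(1) w(2)] by simp
  ultimately have "S (w 0) = S ?z + S (?P n (x n)) + S (?P (Suc n) (w (Suc n)))"
    using P_in x w(1) V(1) by (simp only: linear_on_add[OF S] subspace_add)
  then have "S (?P n (x n)) = S (w 0) - S ?z - S (?P (Suc n) (w (Suc n)))"
    by simp
  then have "infdist (S (?P n (x n))) (W n) \<le> infdist (S (w 0)) (W n) + infdist (S ?z) (W n) +
      infdist (S (?P (Suc n) (w (Suc n)))) (W n)"
    by (simp only:)
      (intro order_trans[OF infdist_diff_le[OF W]] add_right_mono infdist_diff_le[OF W])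
  also have "\<dots> \<le> norm (S (w 0)) + norm (S ?z) + infdist (S (?P (Suc n) (w (Suc n)))) (W n)"
    by (intro add_mono infdist_le_norm[OF W] order_refl)
  finally show ?thesis .
qed

text \<open>If no \<open>n\<close> is as desired, there are humps \<open>x n\<close> that the \<open>n\<close>-th map sends far away
  from \<open>W n\<close>, yet so small that \<open>z = (\<Sum>n. T 0 (\<dots> (T (n - 1) (x n))))\<close> converges. Modulo
  \<open>W n\<close> the terms after the \<open>n\<close>-th contribute boundedly to \<open>S z\<close> by assumption, so the norm of
  \<open>S z\<close> exceeds every \<open>n\<close>.\<close>
theorem gliding_hump:
  assumes bounded: "\<And>n. \<exists>C. \<forall>x\<in>V. infdist (S (foldr T [0..<Suc n] x)) (W n) \<le> C * norm x"
  shows "\<exists>n C. \<forall>x\<in>V. infdist (S (foldr T [0..<n] x)) (W n) \<le> C * norm x"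
proof (rule ccontr)
  let ?P = "\<lambda>n. foldr T [0..<n]"
  assume "\<not> ?thesis"
  then have unbounded: "\<exists>x\<in>V. infdist (S (?P n x)) (W n) > C * norm x" for n C
    by (meson not_le)
  obtain C where C: "\<And>n x. x \<in> V \<Longrightarrow> infdist (S (?P (Suc n) x)) (W n) \<le> C n * norm x"
    using bounded by metis
  obtain x where x: "\<And>n. x n \<in> V" "\<And>m n. m \<le> n \<Longrightarrow> norm (foldr T [m..<n] (x n)) \<le> (1 / 2) ^ n"
    and hump: "\<And>n. infdist (S (?P n (x n))) (W n) >
      real n + \<bar>C n\<bar> * 2 + norm (S (\<Sum>j<n. ?P j (x j)))"
    using ex_hump_sequence[OF unbounded, of "\<lambda>n. real n + \<bar>C n\<bar> * 2"] by blast
  have "\<exists>w. \<forall>m. w m \<in> V \<and> w m = x m + T m (w (Suc m)) \<and> norm (w m) \<le> 2"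
    using V T x by (rule ex_backward_recursion)
  then obtain w where w: "\<And>m. w m \<in> V" "\<And>m. w m = x m + T m (w (Suc m))" "\<And>m. norm (w m) \<le> 2"
    by blast
  have "real n < norm (S (w 0))" for n
  proof -
    have "infdist (S (?P (Suc n) (w (Suc n)))) (W n) \<le> C n * norm (w (Suc n))"
      using w(1) by (rule C)
    also have "\<dots> \<le> \<bar>C n\<bar> * 2"
      using w(3) by (intro mult_mono) auto
    finally show ?thesis
      using hump[of n] infdist_hump_le[of x w n, OF x(1) w(1,2)] by simp
  qed
  then show False
    using reals_Archimedean2[of "norm (S (w 0))"] less_asym by blast
qed

end

section \<open>Commutative unital Banach algebras\<close>

lemma poly_pderiv_prod_linear_nonzero:
  fixes A :: "'a::idom set"
  assumes "finite A" "r \<in> A"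
  shows "poly (pderiv (\<Prod>a\<in>A. [:- a, 1:])) r \<noteq> 0"
proof -
  have pderiv_factor: "pderiv [:- a, 1:] = 1" for a :: 'a
    by (simp add: pderiv_pCons one_pCons)
  have "poly (pderiv (\<Prod>a\<in>A. [:- a, 1:])) r = (\<Sum>a\<in>A. \<Prod>b\<in>A - {a}. r - b)"
    by (simp add: pderiv_prod pderiv_factor poly_sum poly_prod)
  also have "\<dots> = (\<Sum>a\<in>A. if a = r then \<Prod>b\<in>A - {r}. r - b else 0)"
    using assms by (intro sum.cong) auto
  finally show ?thesis
    using assms by auto
qed

interpretation complex_vector:
  vector_space "scaleC :: complex \<Rightarrow> 'a \<Rightarrow> 'a::complex_banach_algebra"
  by unfold_locales (simp_all add: scaleC_add_right scaleC_add_left scaleC_scaleC scaleC_one)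

lemma bounded_linear_scaleC_left: "bounded_linear (\<lambda>c. scaleC c (x::'a::complex_banach_algebra))"
  by (rule bounded_linear_intro[where K = "norm x"])
    (simp_all add: scaleC_add_left scaleR_scaleC scaleR_conv_of_real norm_scaleC)

lemma norm_mean_le:
  fixes f :: "'i \<Rightarrow> 'a::complex_banach_algebra"
  assumes "\<And>i. i \<in> I \<Longrightarrow> norm (f i) \<le> K" "K \<ge> 0"
  shows "norm (scaleC (1 / of_nat (card I)) (sum f I)) \<le> K"
  using sum_norm_bound[of I f K] assms
  by (cases "card I = 0") (auto simp: norm_scaleC norm_divide field_simps)

lemma sum_power_roots_unity:
  assumes "i < n"
  shows "(\<Sum>\<omega> | \<omega> ^ n = (1::complex). \<omega> ^ i) = (if i = 0 then of_nat n else 0)"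
proof (cases "i = 0")
  case True
  with assms show ?thesis by (simp add: card_roots_unity_eq)
next
  case False
  define \<zeta> where "\<zeta> = cis (2 * pi / n)"
  have bij: "bij_betw (\<lambda>k. \<zeta> ^ k) {..<n} {\<omega>. \<omega> ^ n = 1}"
    using Complex.bij_betw_roots_unity[of n] assms
    by (simp add: \<zeta>_def Complex.DeMoivre mult.commute)
  have "\<zeta> ^ i \<noteq> \<zeta> ^ 0"
    using bij assms False
    by (metis bij_betw_def inj_on_def lessThan_iff gr_zeroI less_nat_zero_code)
  have \<zeta>: "\<zeta> ^ n = 1"
    using assms by (simp add: \<zeta>_def Complex.DeMoivre)
  have "(\<Sum>\<omega> | \<omega> ^ n = (1::complex). \<omega> ^ i) = (\<Sum>k<n. (\<zeta> ^ k) ^ i)"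
    using bij by (rule sum.reindex_bij_betw[symmetric])
  also have "\<dots> = (\<Sum>k<n. (\<zeta> ^ i) ^ k)"
    by (simp add: power_mult[symmetric] mult.commute)
  also have "\<dots> = ((\<zeta> ^ i) ^ n - 1) / (\<zeta> ^ i - 1)"
    using \<open>\<zeta> ^ i \<noteq> \<zeta> ^ 0\<close> by (intro geometric_sum) simp
  also have "(\<zeta> ^ i) ^ n = (\<zeta> ^ n) ^ i"
    by (simp add: power_mult[symmetric] mult.commute)
  finally show ?thesis
    using False \<zeta> by simp
qed

lemma tendsto_if_small_relative_error:
  fixes f :: "'i \<Rightarrow> 'a::real_normed_vector"
  assumes error: "\<forall>\<^sub>F x in F. norm (f x - l) \<le> g x * norm (f x)" and g: "(g \<longlongrightarrow> 0) F"
  shows "(f \<longlongrightarrow> l) F"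
proof -
  have "\<forall>\<^sub>F x in F. \<bar>g x\<bar> < 1 / 2"
    using tendsto_rabs_zero[OF g] by (rule order_tendstoD) simp
  with error have "\<forall>\<^sub>F x in F. norm (f x - l) \<le> \<bar>g x\<bar> * (2 * norm l)"
  proof eventually_elim
    case (elim x)
    have g_le: "g x * norm (f x) \<le> \<bar>g x\<bar> * norm (f x)"
      by (intro mult_right_mono) auto
    also have "\<dots> \<le> 1 / 2 * norm (f x)"
      using elim by (intro mult_right_mono) auto
    finally have "norm (f x) \<le> 2 * norm l"
      using elim norm_triangle_sub[of "f x" l] by simp
    then have "\<bar>g x\<bar> * norm (f x) \<le> \<bar>g x\<bar> * (2 * norm l)"
      by (intro mult_left_mono) auto
    with elim g_le show ?case by linarith
  qed
  moreover have "((\<lambda>x. \<bar>g x\<bar> * (2 * norm l)) \<longlongrightarrow> 0) F"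
    by (intro tendsto_mult_left_zero tendsto_rabs_zero g)
  ultimately have "((\<lambda>x. f x - l) \<longlongrightarrow> 0) F"
    by (rule Lim_null_comparison)
  then show ?thesis by (simp add: LIM_zero_iff)
qed

locale comm_banach_subalgebra =
  fixes B :: "'a::complex_banach_algebra set" and e :: 'a
  assumes closed: "closed B"
    and add_closed [simp]: "x \<in> B \<Longrightarrow> y \<in> B \<Longrightarrow> x + y \<in> B"
    and scaleC_closed [simp]: "x \<in> B \<Longrightarrow> scaleC c x \<in> B"
    and mult_closed [simp]: "x \<in> B \<Longrightarrow> y \<in> B \<Longrightarrow> x * y \<in> B"
    and mult_commute: "x \<in> B \<Longrightarrow> y \<in> B \<Longrightarrow> x * y = y * x"
    and unit_closed [simp]: "e \<in> B"
    and unit_mult [simp]: "x \<in> B \<Longrightarrow> e * x = x"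
begin

lemma mult_unit [simp]: "x \<in> B \<Longrightarrow> x * e = x"
  using mult_commute[of x e] by simp

lemma mult_left_commute: "x \<in> B \<Longrightarrow> y \<in> B \<Longrightarrow> x * (y * z) = y * (x * z)"
  by (metis mult.assoc mult_commute)

lemma zero_closed [simp]: "0 \<in> B"
  using scaleC_closed[OF unit_closed, of 0] by simp

lemma minus_closed [simp]: "x \<in> B \<Longrightarrow> - x \<in> B"
  using scaleC_closed[of x "- 1"] by simp

lemma diff_closed [simp]: "x \<in> B \<Longrightarrow> y \<in> B \<Longrightarrow> x - y \<in> B"
  using add_closed[of x "- y"] by simp

lemma scaleR_closed [simp]: "x \<in> B \<Longrightarrow> r *\<^sub>R x \<in> B"
  by (simp add: scaleR_scaleC)

lemma sum_closed [simp]: "(\<And>i. i \<in> I \<Longrightarrow> f i \<in> B) \<Longrightarrow> sum f I \<in> B"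
  by (induction I rule: infinite_finite_induct) auto

lemma subspace: "subspace B"
  by (simp add: subspace_def)

lemma suminf_closed:
  assumes "\<And>n. f n \<in> B" "summable f"
  shows "suminf f \<in> B"
  using closed_sequentially[OF closed _ summable_LIMSEQ[OF assms(2)]] assms(1) by simp

lemma subspace_mult_image: "subspace ((*) a ` B)"
  using subspace by (intro linear_subspace_image bounded_linear.linear bounded_linear_mult_right)

primrec epow :: "'a \<Rightarrow> nat \<Rightarrow> 'a" where
  "epow x 0 = e"
| "epow x (Suc n) = x * epow x n"

lemma epow_closed [simp]: "x \<in> B \<Longrightarrow> epow x n \<in> B"
  by (induction n) auto

lemma norm_epow_le: "norm (epow x n) \<le> norm x ^ n * norm e"
proof (induction n)
  case (Suc n)
  have "norm (epow x (Suc n)) \<le> norm x * norm (epow x n)"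
    by (simp add: norm_mult_ineq)
  also have "\<dots> \<le> norm x * (norm x ^ n * norm e)"
    by (intro mult_left_mono Suc) auto
  finally show ?case by (simp add: mult.assoc)
qed simp

lemma epow_scaleC: "epow (scaleC c x) n = scaleC (c ^ n) (epow x n)"
  by (induction n)
    (simp_all add: mult_scaleC_left mult_scaleC_right scaleC_scaleC mult.commute)

lemma epow_scaleR: "epow (r *\<^sub>R x) n = r ^ n *\<^sub>R epow x n"
  by (simp add: scaleR_scaleC epow_scaleC)

lemma epow_mult: "x \<in> B \<Longrightarrow> y \<in> B \<Longrightarrow> epow (x * y) n = epow x n * epow y n"
  by (induction n) (simp_all add: mult.assoc mult_left_commute[of "epow x _" y])

lemma unit_minus_epow:
  assumes "x \<in> B"
  shows "e - epow x n = (e - x) * (\<Sum>i<n. epow x i)"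
proof (induction n)
  case (Suc n)
  then have "(e - x) * (\<Sum>i<Suc n. epow x i) = (e - epow x n) + (e - x) * epow x n"
    by (simp add: distrib_left)
  with assms show ?case
    by (simp add: left_diff_distrib)
qed simp

definition peval :: "complex poly \<Rightarrow> 'a \<Rightarrow> 'a" where
  "peval p x = fold_coeffs (\<lambda>c y. scaleC c e + x * y) p 0"

lemma peval_0 [simp]: "peval 0 x = 0"
  by (simp add: peval_def)

lemma peval_pCons [simp]: "peval (pCons c p) x = scaleC c e + x * peval p x"
  by (cases "p = 0 \<and> c = 0") (auto simp: peval_def)

lemma peval_closed [simp]: "x \<in> B \<Longrightarrow> peval p x \<in> B"
  by (induction p) auto

lemma peval_add: "peval (p + q) x = peval p x + peval q x"
proof (induction p arbitrary: q)
  case (pCons a p)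
  then show ?case
    by (cases q) (simp add: scaleC_add_left distrib_left)
qed simp

lemma peval_smult: "peval (smult c p) x = scaleC c (peval p x)"
  by (induction p) (simp_all add: scaleC_scaleC scaleC_add_right mult_scaleC_right)

lemma peval_diff: "peval (p - q) x = peval p x - peval q x"
  using peval_add[of "p - q" q x] by simp

lemma peval_mult: "x \<in> B \<Longrightarrow> peval (p * q) x = peval p x * peval q x"
  by (induction p)
    (simp_all add: peval_add peval_smult mult_scaleC_left distrib_right mult.assoc)

lemma peval_linear_factor: "x \<in> B \<Longrightarrow> peval [:- c, 1:] x = x - scaleC c e"
  by simp

definition has_inverse :: "'a \<Rightarrow> bool" where
  "has_inverse x \<longleftrightarrow> (\<exists>y\<in>B. x * y = e)"

definition einv :: "'a \<Rightarrow> 'a" where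
  "einv x = (SOME y. y \<in> B \<and> x * y = e)"

lemma
  assumes "has_inverse x"
  shows einv_closed: "einv x \<in> B" and mult_einv: "x * einv x = e"
proof -
  have "einv x \<in> B \<and> x * einv x = e"
    using assms unfolding has_inverse_def einv_def Bex_def by (rule someI_ex)
  then show "einv x \<in> B" "x * einv x = e" by simp_all
qed

lemma has_inverseI: "x * y = e \<Longrightarrow> y \<in> B \<Longrightarrow> has_inverse x"
  by (auto simp: has_inverse_def)

lemma einv_unique:
  assumes "x \<in> B" "y \<in> B" "x * y = e"
  shows "einv x = y"
proof -
  have inv: "has_inverse x"
    using assms by (intro has_inverseI)
  have "einv x = einv x * (x * y)"
    using assms einv_closed[OF inv] by simp
  also have "\<dots> = (x * einv x) * y"
    using assms(1) einv_closed[OF inv] by (simp add: mult.assoc mult_left_commute)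
  finally show ?thesis
    using assms mult_einv[OF inv] by simp
qed

lemma eq_0_if_has_inverse_mult_eq_0:
  assumes inv: "has_inverse x" and "x \<in> B" "y \<in> B" "x * y = 0"
  shows "y = 0"
proof -
  have "y = (x * einv x) * y"
    using assms(3) by (simp add: mult_einv[OF inv])
  also have "\<dots> = einv x * (x * y)"
    using assms(2) einv_closed[OF inv] by (simp add: mult.assoc mult_left_commute[of x])
  finally show ?thesis
    using assms(4) by simp
qed

lemma has_inverse_unit [simp]: "has_inverse e"
  by (rule has_inverseI[of e e]) simp_all

lemma einv_unit [simp]: "einv e = e"
  by (rule einv_unique) simp_all

lemma has_inverse_factor: "has_inverse (x * y) \<Longrightarrow> y \<in> B \<Longrightarrow> has_inverse x"
  by (rule has_inverseI[of x "y * einv (x * y)"])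
    (simp_all add: einv_closed mult_einv mult.assoc[symmetric])

lemma has_inverse_mult:
  assumes "has_inverse x" "has_inverse y" "x \<in> B"
  shows "has_inverse (x * y)"
proof (rule has_inverseI)
  have "x * y * (einv y * einv x) = x * (y * einv y) * einv x"
    by (simp only: mult.assoc)
  then show "x * y * (einv y * einv x) = e"
    using assms by (simp add: mult_einv)
qed (use assms in \<open>simp add: einv_closed\<close>)

lemma has_inverse_scaleC: "has_inverse x \<Longrightarrow> c \<noteq> 0 \<Longrightarrow> has_inverse (scaleC c x)"
  by (rule has_inverseI[of _ "scaleC (1 / c) (einv x)"])
    (simp_all add: mult_scaleC_left mult_scaleC_right scaleC_scaleC mult_einv einv_closed)

lemma has_inverse_unit_minus:
  assumes x: "x \<in> B" and "norm x < 1"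
  shows "has_inverse (e - x)"
proof (rule has_inverseI)
  have "summable (\<lambda>n. norm x ^ n * norm e)"
    using assms by (intro summable_mult2 summable_geometric) simp
  then have summable: "summable (epow x)"
    by (rule summable_comparison_test') (rule norm_epow_le)
  then show closed: "suminf (epow x) \<in> B"
    using x by (intro suminf_closed) simp
  have "x * suminf (epow x) = suminf (epow x) - e"
    using suminf_mult[OF summable, of x] suminf_split_head[OF summable] by simp
  then show "(e - x) * suminf (epow x) = e"
    using closed by (simp add: left_diff_distrib)
qed

lemma has_inverse_unit_minus_if_epow_small:
  assumes "x \<in> B" and "norm (epow x n) < 1"
  shows "has_inverse (e - x)"
proof -
  have "has_inverse ((e - x) * (\<Sum>i<n. epow x i))"
    using has_inverse_unit_minus[of "epow x n"] assms by (simp add: unit_minus_epow)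
  then show ?thesis
    by (rule has_inverse_factor) (simp add: assms)
qed

lemma has_inverse_unit_minus_if_epow_tendsto_0:
  assumes "x \<in> B" and "epow x \<longlonglongrightarrow> 0"
  shows "has_inverse (e - x)"
proof -
  have "\<forall>\<^sub>F n in sequentially. norm (epow x n) < 1"
    using tendsto_norm_zero[OF assms(2)] by (rule order_tendstoD) simp
  then obtain n where "norm (epow x n) < 1"
    by (auto simp: eventually_sequentially)
  with assms(1) show ?thesis
    by (rule has_inverse_unit_minus_if_epow_small)
qed

lemma einv_diff:
  assumes "x \<in> B" "y \<in> B" "has_inverse x" "has_inverse y"
  shows "einv x - einv y = (y - x) * (einv y * einv x)"
proof -
  have "y * (einv y * einv x) = einv x"
    using assms by (simp add: mult.assoc[symmetric] mult_einv einv_closed)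
  moreover have "x * (einv y * einv x) = einv y"
    using assms by (simp add: mult_left_commute[of x] mult_einv einv_closed)
  ultimately show ?thesis
    by (simp add: left_diff_distrib)
qed

lemma continuous_on_einv: "continuous_on {x \<in> B. has_inverse x} einv"
  unfolding continuous_on_def
proof safe
  fix y assume y: "y \<in> B" "has_inverse y"
  show "(einv \<longlongrightarrow> einv y) (at y within {x \<in> B. has_inverse x})"
  proof (rule tendsto_if_small_relative_error)
    have "norm (einv x - einv y) \<le> norm (y - x) * norm (einv y) * norm (einv x)"
      if "x \<in> B" "has_inverse x" for x
      using that y by (simp add: einv_diff mult.assoc order_trans[OF norm_mult_ineq]
          mult_left_mono norm_mult_ineq)
    then show "\<forall>\<^sub>F x in at y within {x \<in> B. has_inverse x}.
        norm (einv x - einv y) \<le> norm (y - x) * norm (einv y) * norm (einv x)"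
      by (simp add: eventually_at_filter)
    have "((\<lambda>x. norm (y - x) * norm (einv y)) \<longlongrightarrow> norm (y - y) * norm (einv y))
        (at y within {x \<in> B. has_inverse x})"
      by (intro tendsto_intros)
    then show "((\<lambda>x. norm (y - x) * norm (einv y)) \<longlongrightarrow> 0) (at y within {x \<in> B. has_inverse x})"
      by simp
  qed
qed

lemma norm_le_1_if_einv_near_unit:
  assumes "x \<in> B" "has_inverse (e - x)" "norm (einv (e - x) - e) \<le> 1 / 2"
  shows "norm x \<le> 1"
proof -
  define d where "d = einv (e - x) - e"
  have "(e - x) * (d + e) = e"
    using mult_einv[OF assms(2)] by (simp add: d_def)
  then have "x = d - x * d"
    using assms(1) einv_closed[OF assms(2)] by (simp add: d_def algebra_simps)
  then have "norm x \<le> norm d + norm (x * d)"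
    by (metis norm_triangle_ineq4)
  also have "\<dots> \<le> norm d + norm x * norm d"
    by (intro add_left_mono norm_mult_ineq)
  also have "\<dots> \<le> 1 / 2 + norm x * (1 / 2)"
    using assms(3) by (intro add_mono mult_left_mono) (simp_all add: d_def)
  finally show ?thesis by simp
qed

definition spectrum :: "'a \<Rightarrow> complex set" where
  "spectrum x = {\<mu>. \<not> has_inverse (x - scaleC \<mu> e)}"

lemma has_inverse_peval:
  assumes x: "x \<in> B" and "p \<noteq> 0" and "\<And>r. poly p r = 0 \<Longrightarrow> r \<notin> spectrum x"
  shows "has_inverse (peval p x)"
  using assms(2,3)
proof (induction "degree p" arbitrary: p)
  case 0
  then obtain c where "p = [:c:]" "c \<noteq> 0"
    by (metis degree_eq_zeroE pCons_0_0)
  then show ?case by (simp add: has_inverse_scaleC)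
next
  case (Suc n)
  then obtain r where r: "poly p r = 0"
    using fundamental_theorem_of_algebra[of p] by (metis constant_degree nat.distinct(1))
  then obtain q where q: "p = [:- r, 1:] * q"
    by (metis dvdE poly_eq_0_iff_dvd)
  with Suc.prems(1) have "q \<noteq> 0" by auto
  then have "degree p = Suc (degree q)"
    unfolding q by (subst degree_mult_eq) auto
  with Suc \<open>q \<noteq> 0\<close> have "has_inverse (peval q x)"
    by (simp add: q)
  moreover have "has_inverse (peval [:- r, 1:] x)"
    unfolding peval_linear_factor[OF x] using Suc.prems(2)[OF r] by (simp add: spectrum_def)
  ultimately show ?case
    unfolding q peval_mult[OF x] using x by (intro has_inverse_mult) simp_all
qed

lemma spectrum_peval_subset:
  assumes x: "x \<in> B" and "\<And>r. r \<in> spectrum x \<Longrightarrow> poly p r = c" and "poly p r\<^sub>0 = c"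
  shows "spectrum (peval p x) \<subseteq> {c}"
proof
  fix \<mu> assume \<mu>: "\<mu> \<in> spectrum (peval p x)"
  show "\<mu> \<in> {c}"
  proof (rule ccontr)
    assume "\<mu> \<notin> {c}"
    then have "has_inverse (peval (p - [:\<mu>:]) x)"
      using assms by (intro has_inverse_peval) auto
    with \<mu> show False
      by (simp add: spectrum_def peval_diff)
  qed
qed

lemma norm_scaleC_unit_minus_multiple_ge:
  assumes a: "a \<in> B" "\<not> has_inverse a" and b: "b \<in> B"
  shows "cmod c \<le> norm (scaleC c e - a * b)"
proof (rule ccontr)
  assume small: "\<not> ?thesis"
  have "c \<noteq> 0"
    using small by auto
  then have "scaleC (1 / c) (scaleC c e - a * b) = e - a * scaleC (1 / c) b"
    by (simp add: complex_vector.scale_right_diff_distrib scaleC_scaleC mult_scaleC_right)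
  moreover have "norm (scaleC (1 / c) (scaleC c e - a * b)) < 1"
    using small \<open>c \<noteq> 0\<close> by (simp add: norm_scaleC norm_divide)
  ultimately have "has_inverse (e - (e - a * scaleC (1 / c) b))"
    using a b by (intro has_inverse_unit_minus) simp_all
  then have "has_inverse a"
    using has_inverse_factor b by simp
  with a show False by simp
qed

lemma cmod_poly_le_infdist_peval:
  assumes x: "x \<in> B" and \<mu>: "\<mu> \<in> spectrum x"
  shows "cmod (poly p \<mu>) \<le> infdist (peval p x) ((*) (x - scaleC \<mu> e) ` B)"
proof -
  let ?a = "x - scaleC \<mu> e"
  have "[:- \<mu>, 1:] dvd p - [:poly p \<mu>:]"
    by (subst poly_eq_0_iff_dvd[symmetric]) simp
  then obtain q where "p - [:poly p \<mu>:] = [:- \<mu>, 1:] * q" ..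
  from arg_cong[OF this, of "\<lambda>p. peval p x"]
  have "peval p x - scaleC (poly p \<mu>) e = ?a * peval q x"
    by (simp only: peval_diff peval_mult[OF x] peval_linear_factor[OF x]) simp
  then have "peval p x = scaleC (poly p \<mu>) e + ?a * peval q x"
    by (simp add: algebra_simps)
  then have "infdist (peval p x) ((*) ?a ` B) = infdist (scaleC (poly p \<mu>) e) ((*) ?a ` B)"
    using infdist_add_subspace[OF subspace_mult_image] x by simp
  moreover have "cmod (poly p \<mu>) \<le> infdist (scaleC (poly p \<mu>) e) ((*) ?a ` B)"
    using norm_scaleC_unit_minus_multiple_ge[of ?a] x \<mu>
    by (subst infdist_notempty) (auto simp: dist_norm spectrum_def intro!: cINF_greatest)
  ultimately show ?thesis by simp
qed

lemma has_inverse_unit_minus_scaleC: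
  assumes "x \<in> B" and "spectrum x \<subseteq> {0}"
  shows "has_inverse (e - scaleC c x)"
proof (cases "c = 0")
  case False
  then have "has_inverse (x - scaleC (1 / c) e)"
    using assms(2) by (auto simp: spectrum_def)
  then have "has_inverse (scaleC (- c) (x - scaleC (1 / c) e))"
    using False by (intro has_inverse_scaleC) simp_all
  then show ?thesis
    using False by (simp add: complex_vector.scale_right_diff_distrib scaleC_scaleC)
qed simp

end

section \<open>The spectral radius formula for trivial spectrum\<close>

context comm_banach_subalgebra
begin

lemma unit_minus_epow_mult_einv:
  assumes x: "x \<in> B" and \<omega>: "\<omega> ^ n = 1" and inv: "has_inverse (e - scaleC \<omega> x)"
  shows "(e - epow x n) * einv (e - scaleC \<omega> x) = (\<Sum>i<n. scaleC (\<omega> ^ i) (epow x i))"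
proof -
  let ?y = "scaleC \<omega> x"
  have "e - epow x n = e - epow ?y n"
    by (simp add: epow_scaleC \<omega>)
  also have "\<dots> = (\<Sum>i<n. epow ?y i) * (e - ?y)"
    using x by (simp add: unit_minus_epow mult_commute[of "e - ?y"])
  finally have "(e - epow x n) * einv (e - ?y) = (\<Sum>i<n. epow ?y i)"
    using x by (simp add: mult.assoc mult_einv[OF inv])
  then show ?thesis
    by (simp add: epow_scaleC)
qed

lemma
  assumes x: "x \<in> B" and n: "n > 0"
    and inv: "\<And>\<omega>. \<omega> ^ n = 1 \<Longrightarrow> has_inverse (e - scaleC \<omega> x)"
  shows has_inverse_unit_minus_epow: "has_inverse (e - epow x n)"
    and einv_unit_minus_epow: "einv (e - epow x n) =
      scaleC (1 / of_nat n) (\<Sum>\<omega> | \<omega> ^ n = 1. einv (e - scaleC \<omega> x))" (is "_ = ?mean")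
proof -
  have "(e - epow x n) * (\<Sum>\<omega> | \<omega> ^ n = 1. einv (e - scaleC \<omega> x)) =
      (\<Sum>\<omega> | \<omega> ^ n = 1. \<Sum>i<n. scaleC (\<omega> ^ i) (epow x i))"
    using unit_minus_epow_mult_einv[OF x _ inv] by (simp add: sum_distrib_left)
  also have "\<dots> = (\<Sum>i<n. scaleC (\<Sum>\<omega> | \<omega> ^ n = 1. \<omega> ^ i) (epow x i))"
    by (subst sum.swap) (simp add: complex_vector.scale_sum_left)
  also have "\<dots> = (\<Sum>i<n. if i = 0 then scaleC (of_nat n) e else 0)"
    by (intro sum.cong refl) (simp add: sum_power_roots_unity)
  also have "\<dots> = scaleC (of_nat n) e"
    using n by simp
  finally have "(e - epow x n) * ?mean = e"
    using n by (simp add: mult_scaleC_right scaleC_scaleC)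
  moreover have "?mean \<in> B"
    using inv by (intro scaleC_closed sum_closed einv_closed) simp
  ultimately show "has_inverse (e - epow x n)" "einv (e - epow x n) = ?mean"
    using x by (simp_all add: has_inverseI einv_unique)
qed

lemma norm_einv_unit_minus_epow_diff_le:
  assumes x: "x \<in> B" and inv: "\<And>c. has_inverse (e - scaleC c x)" and "n > 0"
    and le: "\<And>\<omega>. \<omega> ^ n = 1 \<Longrightarrow> norm (einv (e - scaleC (\<omega> * of_real s) x) -
      einv (e - scaleC (\<omega> * of_real t) x)) \<le> \<eta>"
  shows "norm (einv (e - epow (s *\<^sub>R x) n) - einv (e - epow (t *\<^sub>R x) n)) \<le> \<eta>"
proof -
  let ?f = "\<lambda>c. einv (e - scaleC c x)" and ?U = "{\<omega>::complex. \<omega> ^ n = 1}"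
  have "einv (e - epow (u *\<^sub>R x) n) = scaleC (1 / of_nat n) (\<Sum>\<omega>\<in>?U. ?f (\<omega> * of_real u))" for u
    using einv_unit_minus_epow[of "u *\<^sub>R x" n] x \<open>n > 0\<close> inv
    by (simp add: scaleR_scaleC scaleC_scaleC)
  then have "einv (e - epow (s *\<^sub>R x) n) - einv (e - epow (t *\<^sub>R x) n) =
      scaleC (1 / of_nat (card ?U)) (\<Sum>\<omega>\<in>?U. ?f (\<omega> * of_real s) - ?f (\<omega> * of_real t))"
    using card_roots_unity_eq[OF \<open>n > 0\<close>]
    by (simp add: sum_subtractf complex_vector.scale_right_diff_distrib)
  also have "norm \<dots> \<le> \<eta>"
    using le order_trans[OF norm_ge_zero le[OF power_one]] by (intro norm_mean_le) simp_all
  finally show ?thesis .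
qed

lemma einv_unit_minus_epow_equicontinuous:
  assumes x: "x \<in> B" and inv: "\<And>c. has_inverse (e - scaleC c x)" and "\<eta> > 0"
  obtains \<delta> where "\<delta> > 0" "\<forall>s\<in>{0..r}. \<forall>t\<in>{0..r}. \<forall>n>0. \<bar>s - t\<bar> < \<delta> \<longrightarrow>
    norm (einv (e - epow (s *\<^sub>R x) n) - einv (e - epow (t *\<^sub>R x) n)) \<le> \<eta>"
proof -
  let ?f = "\<lambda>c. einv (e - scaleC c x)"
  have "continuous_on (cball 0 r) (\<lambda>c. e - scaleC c x)"
    by (intro continuous_intros bounded_linear.continuous_on[OF bounded_linear_scaleC_left])
  then have "continuous_on (cball 0 r) ?f"
    by (rule continuous_on_compose2[OF continuous_on_einv]) (use x inv in auto)
  then have "uniformly_continuous_on (cball 0 r) ?f"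
    by (intro compact_uniformly_continuous compact_cball)
  then obtain \<delta> where "\<delta> > 0" and \<delta>:
      "\<And>a b. cmod a \<le> r \<Longrightarrow> cmod b \<le> r \<Longrightarrow> cmod (a - b) < \<delta> \<Longrightarrow> norm (?f a - ?f b) < \<eta>"
    using \<open>\<eta> > 0\<close> unfolding uniformly_continuous_on_def dist_norm by (metis mem_cball_0)
  have "norm (einv (e - epow (s *\<^sub>R x) n) - einv (e - epow (t *\<^sub>R x) n)) \<le> \<eta>"
    if s: "0 \<le> s" "s \<le> r" and t: "0 \<le> t" "t \<le> r" and "n > 0" and "\<bar>s - t\<bar> < \<delta>" for s t n
  proof -
    have "norm (?f (\<omega> * of_real s) - ?f (\<omega> * of_real t)) \<le> \<eta>" if "\<omega> ^ n = 1" for \<omega>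
    proof -
      have "cmod \<omega> = 1"
        using power_eq_1_iff[OF that] \<open>n > 0\<close> by simp
      moreover have "cmod (\<omega> * of_real s - \<omega> * of_real t) = cmod \<omega> * \<bar>s - t\<bar>"
        by (simp flip: right_diff_distrib of_real_diff add: norm_mult)
      ultimately show ?thesis
        using s t \<open>\<bar>s - t\<bar> < \<delta>\<close> by (intro less_imp_le[OF \<delta>]) (simp_all add: norm_mult)
    qed
    with x inv \<open>n > 0\<close> show ?thesis
      by (rule norm_einv_unit_minus_epow_diff_le)
  qed
  with \<open>\<delta> > 0\<close> that show ?thesis by simp
qed

lemma epow_scaleR_tendsto_0_mono:
  assumes bounded: "\<forall>\<^sub>F n in sequentially. norm (epow (t *\<^sub>R x) n) \<le> 1" and u: "0 \<le> u" "u < t"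
  shows "epow (u *\<^sub>R x) \<longlonglongrightarrow> 0"
proof (rule Lim_null_comparison)
  show "(\<lambda>n. (u / t) ^ n) \<longlonglongrightarrow> 0"
    using u by (intro LIMSEQ_power_zero) simp
  show "\<forall>\<^sub>F n in sequentially. norm (epow (u *\<^sub>R x) n) \<le> (u / t) ^ n"
    using bounded
  proof eventually_elim
    case (elim n)
    have "norm (epow (u *\<^sub>R x) n) = (u / t) ^ n * norm (epow (t *\<^sub>R x) n)"
      using u by (simp add: epow_scaleR power_divide)
    with elim u show ?case
      by (simp add: mult_left_le)
  qed
qed

lemma epow_scaleR_tendsto_0_step:
  assumes x: "x \<in> B" and inv: "\<And>c. has_inverse (e - scaleC c x)"
    and lim: "epow (s *\<^sub>R x) \<longlonglongrightarrow> 0"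
    and close: "\<forall>n>0. norm (einv (e - epow (t *\<^sub>R x) n) - einv (e - epow (s *\<^sub>R x) n)) \<le> 1 / 4"
    and u: "0 \<le> u" "u < t"
  shows "epow (u *\<^sub>R x) \<longlonglongrightarrow> 0"
proof (rule epow_scaleR_tendsto_0_mono[OF _ u])
  have inv_epow: "has_inverse (e - epow (r *\<^sub>R x) n)" if "n > 0" for r n
    using x that inv
    by (intro has_inverse_unit_minus_epow) (simp_all add: scaleR_scaleC scaleC_scaleC)
  have "(\<lambda>n. e - epow (s *\<^sub>R x) n) \<longlonglongrightarrow> e - 0"
    by (intro tendsto_intros lim)
  then have "(\<lambda>n. einv (e - epow (s *\<^sub>R x) n)) \<longlonglongrightarrow> einv e"
    using x inv_epow
    by (intro continuous_on_tendsto_compose[OF continuous_on_einv]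
        eventually_sequentiallyI[of 1]) auto
  then have "\<forall>\<^sub>F n in sequentially. dist (einv (e - epow (s *\<^sub>R x) n)) e < 1 / 4"
    by (intro tendstoD) simp_all
  with eventually_gt_at_top[of 0] show "\<forall>\<^sub>F n in sequentially. norm (epow (t *\<^sub>R x) n) \<le> 1"
  proof eventually_elim
    case (elim n)
    then have "dist (einv (e - epow (t *\<^sub>R x) n)) e \<le> 1 / 4 + 1 / 4"
      using close by (intro dist_triangle_le[of _ "einv (e - epow (s *\<^sub>R x) n)"] add_mono)
        (auto simp: dist_norm norm_minus_commute[of e])
    with elim x show ?case
      by (intro norm_le_1_if_einv_near_unit inv_epow) (simp_all add: dist_norm)
  qed
qed

definition quasinilpotent :: "'a \<Rightarrow> bool" where
  "quasinilpotent x \<longleftrightarrow> (\<forall>r\<ge>0. epow (r *\<^sub>R x) \<longlonglongrightarrow> 0)"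

text \<open>Averaging the resolvent over the \<open>n\<close>-th roots of unity inverts \<open>e - (t x)\<^sup>n\<close>, and
  uniform continuity of the resolvent on discs makes these inverses equicontinuous in \<open>t\<close>. So
  the convergence \<open>(t x)\<^sup>n \<rightarrow> 0\<close> propagates from \<open>t = 0\<close> by steps of a fixed length.\<close>
theorem quasinilpotent_if_spectrum_trivial:
  assumes x: "x \<in> B" and spectrum: "spectrum x \<subseteq> {0}"
  shows "quasinilpotent x"
  unfolding quasinilpotent_def
proof safe
  fix r :: real assume "r \<ge> 0"
  have inv: "has_inverse (e - scaleC c x)" for c
    using assms by (rule has_inverse_unit_minus_scaleC)
  obtain \<delta> where "\<delta> > 0" and \<delta>: "\<forall>s\<in>{0..r + 1}. \<forall>t\<in>{0..r + 1}. \<forall>n>0. \<bar>s - t\<bar> < \<delta> \<longrightarrow>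
      norm (einv (e - epow (s *\<^sub>R x) n) - einv (e - epow (t *\<^sub>R x) n)) \<le> 1 / 4"
    by (rule einv_unit_minus_epow_equicontinuous[OF x inv, of "1 / 4" "r + 1"]) simp_all
  define h where "h = min (\<delta> / 2) 1"
  have h: "h > 0" "h \<le> 1" "h < \<delta>"
    using \<open>\<delta> > 0\<close> by (auto simp: h_def)
  have "epow (t *\<^sub>R x) \<longlonglongrightarrow> 0" if "0 \<le> t" "t \<le> r" "t \<le> real m * (h / 2)" for m t
    using that
  proof (induction m arbitrary: t)
    case 0
    then have "t = 0" by simp
    then show ?case
      by (intro LIMSEQ_imp_Suc[of "epow _"]) simp
  next
    case (Suc m)
    define s where "s = max 0 (t - h / 2)"
    have s: "0 \<le> s" "s \<le> r" "s \<le> real m * (h / 2)" "t < s + h"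
      using Suc.prems h by (auto simp: s_def max_def algebra_simps)
    show ?case
    proof (rule epow_scaleR_tendsto_0_step[OF x inv])
      show "epow (s *\<^sub>R x) \<longlonglongrightarrow> 0"
        using s by (intro Suc.IH)
      show "\<forall>n>0. norm (einv (e - epow ((s + h) *\<^sub>R x) n) - einv (e - epow (s *\<^sub>R x) n)) \<le> 1 / 4"
        using s h by (intro allI impI \<delta>[rule_format]) auto
    qed (use Suc.prems s in simp_all)
  qed
  moreover obtain m where "r \<le> real m * (h / 2)"
    using reals_Archimedean3[of "h / 2"] h(1) by (metis half_gt_zero less_imp_le)
  ultimately show "epow (r *\<^sub>R x) \<longlonglongrightarrow> 0"
    using \<open>r \<ge> 0\<close> by blast
qed

lemma quasinilpotent_if_square_zero:
  assumes "x * x = 0"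
  shows "quasinilpotent x"
proof -
  have "epow (r *\<^sub>R x) (n + 2) = 0" for r n
    using assms by (simp add: mult.assoc[symmetric])
  then have "(\<lambda>n. epow (r *\<^sub>R x) (n + 2)) \<longlonglongrightarrow> 0" for r
    by (simp only: tendsto_const)
  then show ?thesis
    unfolding quasinilpotent_def by (blast intro: LIMSEQ_offset)
qed

definition radical :: "'a set" where
  "radical = {x \<in> B. \<forall>y\<in>B. has_inverse (e - y * x)}"

lemma quasinilpotent_in_radical:
  assumes x: "x \<in> B" and "quasinilpotent x"
  shows "x \<in> radical"
proof -
  have "has_inverse (e - y * x)" if y: "y \<in> B" for y
  proof (rule has_inverse_unit_minus_if_epow_tendsto_0)
    have "epow (norm y *\<^sub>R x) \<longlonglongrightarrow> 0"
      using assms(2) by (simp add: quasinilpotent_def)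
    from tendsto_mult_right_zero[OF tendsto_norm_zero[OF this], of "norm e"]
    show "epow (y * x) \<longlonglongrightarrow> 0"
    proof (rule Lim_null_comparison[OF always_eventually, rotated], safe)
      fix n
      have "norm (epow (y * x) n) \<le> norm (epow y n) * norm (epow x n)"
        using x y by (simp add: epow_mult norm_mult_ineq)
      also have "\<dots> \<le> (norm y ^ n * norm e) * norm (epow x n)"
        by (intro mult_right_mono norm_epow_le norm_ge_zero)
      finally show "norm (epow (y * x) n) \<le> norm e * norm (epow (norm y *\<^sub>R x) n)"
        by (simp add: epow_scaleR mult_ac)
    qed
  qed (simp add: x y)
  with x show ?thesis
    by (simp add: radical_def)
qed

end

section \<open>Derivations of commutative Banach algebras\<close>

context comm_banach_subalgebra
begin

definition ad :: "'a \<Rightarrow> ('a \<Rightarrow> 'a) \<Rightarrow> 'a \<Rightarrow> 'a" where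
  "ad a T = (\<lambda>y. T (a * y) - a * T y)"

lemma ad_pow_Suc: "(ad a ^^ Suc m) T y = (ad a ^^ m) T (a * y) - a * (ad a ^^ m) T y"
  by (simp add: ad_def)

lemma ad_pow_closed:
  assumes a: "a \<in> B" and T: "\<And>y. y \<in> B \<Longrightarrow> T y \<in> B" and y: "y \<in> B"
  shows "(ad a ^^ m) T y \<in> B"
  using y
proof (induction m arbitrary: y)
  case (Suc m)
  then show ?case
    unfolding ad_pow_Suc using a by simp
qed (simp add: T)

lemma norm_ad_pow_le:
  assumes a: "a \<in> B" and T: "\<And>y. y \<in> B \<Longrightarrow> norm (T y) \<le> C * norm y" and "C \<ge> 0" and y: "y \<in> B"
  shows "norm ((ad a ^^ m) T y) \<le> (2 * norm a) ^ m * C * norm y"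
  using y
proof (induction m arbitrary: y)
  case (Suc m)
  let ?E = "(ad a ^^ m) T" and ?K = "(2 * norm a) ^ m * C"
  have "norm (?E (a * y)) \<le> ?K * norm (a * y)"
    using Suc a by simp
  also have "\<dots> \<le> ?K * (norm a * norm y)"
    using \<open>C \<ge> 0\<close> by (intro mult_left_mono norm_mult_ineq) simp
  finally have "norm (?E (a * y)) \<le> ?K * (norm a * norm y)" .
  moreover have "norm (a * ?E y) \<le> norm a * (?K * norm y)"
    using Suc by (intro order_trans[OF norm_mult_ineq] mult_left_mono) simp_all
  ultimately show ?case
    unfolding ad_pow_Suc using norm_triangle_ineq4[of "?E (a * y)" "a * ?E y"]
    by (simp add: algebra_simps)
qed (simp add: T)

end

locale subalgebra_derivation = comm_banach_subalgebra B e
  for B :: "'a::complex_banach_algebra set" and e :: 'a +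
  fixes D :: "'a \<Rightarrow> 'a"
  assumes D_closed [simp]: "x \<in> B \<Longrightarrow> D x \<in> B"
    and D_add: "x \<in> B \<Longrightarrow> y \<in> B \<Longrightarrow> D (x + y) = D x + D y"
    and D_scaleC: "x \<in> B \<Longrightarrow> D (scaleC c x) = scaleC c (D x)"
    and D_mult: "x \<in> B \<Longrightarrow> y \<in> B \<Longrightarrow> D (x * y) = D x * y + x * D y"
begin

lemma linear_on_D: "linear_on B D"
  by (simp add: linear_on_def D_add D_scaleC scaleR_scaleC)

lemma D_zero [simp]: "D 0 = 0"
  using linear_on_zero[OF linear_on_D subspace] .

lemma D_diff: "x \<in> B \<Longrightarrow> y \<in> B \<Longrightarrow> D (x - y) = D x - D y"
  using linear_on_diff[OF linear_on_D subspace] .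

lemma D_unit [simp]: "D e = 0"
  using D_mult[of e e] by simp

lemma D_peval:
  assumes "x \<in> B"
  shows "D (peval p x) = peval (pderiv p) x * D x"
proof (induction p)
  case (pCons c p)
  then show ?case
    using assms mult_commute[of "D x" "peval p x"]
    by (simp add: D_add D_scaleC D_mult pderiv_pCons peval_add distrib_right mult.assoc)
qed simp

definition separating_space :: "'a set" where
  "separating_space = {s. \<exists>f. (\<forall>n. f n \<in> B) \<and> f \<longlonglongrightarrow> 0 \<and> (\<lambda>n. D (f n)) \<longlonglongrightarrow> s}"

lemma separating_space_closed: "s \<in> separating_space \<Longrightarrow> s \<in> B"
  unfolding separating_space_def by (auto intro: closed_sequentially[OF closed D_closed])

lemma D_mult_tendsto:
  assumes a: "a \<in> B" and f: "\<And>n. f n \<in> B" "f \<longlonglongrightarrow> 0" "(\<lambda>n. D (f n)) \<longlonglongrightarrow> s"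
  shows "(\<lambda>n. D (a * f n)) \<longlonglongrightarrow> a * s"
proof -
  have "(\<lambda>n. D a * f n + a * D (f n)) \<longlonglongrightarrow> D a * 0 + a * s"
    using f by (intro tendsto_intros)
  then show ?thesis
    using a f(1) by (simp add: D_mult)
qed

lemma separating_space_mult:
  assumes a: "a \<in> B" and s: "s \<in> separating_space"
  shows "a * s \<in> separating_space"
proof -
  obtain f where f: "\<And>n. f n \<in> B" "f \<longlonglongrightarrow> 0" "(\<lambda>n. D (f n)) \<longlonglongrightarrow> s"
    using s by (auto simp: separating_space_def)
  moreover have "(\<lambda>n. a * f n) \<longlonglongrightarrow> 0"
    using f by (intro tendsto_mult_right_zero)
  ultimately show ?thesis
    using D_mult_tendsto[OF a f] a unfolding separating_space_def
    by (auto intro!: exI[of _ "\<lambda>n. a * f n"])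
qed

lemma infdist_D_mult_le:
  assumes "a \<in> B" "b \<in> B" "x \<in> B"
  shows "infdist (D (b * a * x)) ((*) a ` B) \<le> norm (D (b * a)) * norm x"
proof -
  have "D (b * a * x) = D (b * a) * x + a * (b * D x)"
    using assms D_mult[of "b * a" x] by (simp add: mult.assoc mult_left_commute[of a])
  then have "infdist (D (b * a * x)) ((*) a ` B) \<le> norm (D (b * a) * x)"
    using assms by (simp add: infdist_add_subspace[OF subspace_mult_image]
        infdist_le_norm[OF subspace_mult_image])
  then show ?thesis
    using norm_mult_ineq order_trans by blast
qed

lemma poly_eq_0_if_D_bounded_mod_factor:
  assumes s: "s \<in> separating_space" and \<mu>: "\<mu> \<in> spectrum s" "\<mu> \<noteq> 0"
    and bounded: "\<And>x. x \<in> B \<Longrightarrow>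
      infdist (D (peval p s * x)) ((*) (s - scaleC \<mu> e) ` B) \<le> C * norm x"
  shows "poly p \<mu> = 0"
proof -
  let ?W = "(*) (s - scaleC \<mu> e) ` B"
  have sB: "s \<in> B"
    using s by (rule separating_space_closed)
  obtain f where f: "\<And>n. f n \<in> B" "f \<longlonglongrightarrow> 0" "(\<lambda>n. D (f n)) \<longlonglongrightarrow> s"
    using s by (auto simp: separating_space_def)
  have "(\<lambda>n. infdist (D (peval p s * f n)) ?W) \<longlonglongrightarrow> infdist (peval p s * s) ?W"
    using D_mult_tendsto[OF peval_closed[OF sB] f] by (intro tendsto_infdist)
  moreover have "(\<lambda>n. C * norm (f n)) \<longlonglongrightarrow> 0"
    using f(2) by (intro tendsto_mult_right_zero tendsto_norm_zero)
  ultimately have "infdist (peval p s * s) ?W \<le> 0"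
    by (rule LIMSEQ_le) (use bounded f(1) in auto)
  moreover have "peval p s * s = peval (p * [:0, 1:]) s"
    unfolding peval_mult[OF sB] using sB by simp
  ultimately have "cmod (poly (p * [:0, 1:]) \<mu>) \<le> 0"
    using cmod_poly_le_infdist_peval[OF sB \<mu>(1)] order_trans by metis
  with \<mu>(2) show ?thesis by simp
qed

lemma peval_prod_lessThan_Suc:
  assumes "s \<in> B"
  shows "peval (\<Prod>i<Suc n. [:- \<mu> i, 1:]) s =
    peval (\<Prod>i<n. [:- \<mu> i, 1:]) s * (s - scaleC (\<mu> n) e)"
  by (simp only: prod.lessThan_Suc peval_mult[OF assms] peval_linear_factor[OF assms])

lemma foldr_mult_linear_factors:
  assumes s: "s \<in> B" and "x \<in> B"
  shows "foldr (\<lambda>i. (*) (s - scaleC (\<mu> i) e)) [0..<n] x = peval (\<Prod>i<n. [:- \<mu> i, 1:]) s * x"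
  using assms(2)
proof (induction n arbitrary: x)
  case (Suc n)
  with s show ?case
    by (simp add: peval_prod_lessThan_Suc mult.assoc del: prod.lessThan_Suc)
qed (simp add: one_pCons)

text \<open>Multiplication by the elements \<open>s - \<mu> n\<close> for infinitely many spectral values \<open>\<mu> n\<close> would
  violate the gliding hump theorem: modulo the multiples of \<open>s - \<mu> n\<close>, the map \<open>x \<mapsto> D ((s - \<mu> 0)
  \<dots> (s - \<mu> n) * x)\<close> is bounded, but without the last factor it is not, because \<open>s\<close> is separating
  and the product of the \<open>\<mu> n - \<mu> i\<close> with \<open>i < n\<close> is nonzero.\<close>
theorem finite_spectrum_if_separating:
  assumes s: "s \<in> separating_space"
  shows "finite (spectrum s)"
proof (rule ccontr)
  assume "infinite (spectrum s)"
  then obtain \<mu> :: "nat \<Rightarrow> complex" where "inj \<mu>" and "range \<mu> \<subseteq> spectrum s - {0}"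
    using infinite_countable_subset[of "spectrum s - {0}"] by auto
  then have \<mu>: "\<mu> n \<in> spectrum s" "\<mu> n \<noteq> 0" for n
    by auto
  have sB: "s \<in> B"
    using s by (rule separating_space_closed)
  let ?a = "\<lambda>n. s - scaleC (\<mu> n) e" and ?p = "\<lambda>n. \<Prod>i<n. [:- \<mu> i, 1:]"
  note foldr_eq = foldr_mult_linear_factors[OF sB]
  have "\<exists>n C. \<forall>x\<in>B. infdist (D (foldr (\<lambda>n. (*) (?a n)) [0..<n] x)) ((*) (?a n) ` B) \<le> C * norm x"
  proof (rule gliding_hump[OF subspace closed bounded_linear_mult_right _ linear_on_D
        subspace_mult_image])
    fix n
    show "\<exists>C. \<forall>x\<in>B. infdist (D (foldr (\<lambda>n. (*) (?a n)) [0..<Suc n] x)) ((*) (?a n) ` B)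
        \<le> C * norm x"
      using infdist_D_mult_le[of "?a n" "peval (?p n) s"] sB
      by (intro exI[of _ "norm (D (peval (?p n) s * ?a n))"] ballI)
        (simp only: foldr_eq peval_prod_lessThan_Suc[OF sB], simp)
  qed (simp add: sB)
  then obtain n C where "\<forall>x\<in>B. infdist (D (foldr (\<lambda>n. (*) (?a n)) [0..<n] x)) ((*) (?a n) ` B)
      \<le> C * norm x"
    by blast
  then have "poly (?p n) (\<mu> n) = 0"
    using foldr_eq by (intro poly_eq_0_if_D_bounded_mod_factor[OF s \<mu>, of _ n C]) auto
  then show False
    by (simp add: poly_prod inj_eq[OF \<open>inj \<mu>\<close>])
qed

text \<open>If \<open>q\<close> has the spectral values of \<open>s\<close> as simple roots, then \<open>q s\<close> is quasinilpotent,
  hence zero, and \<open>0 = D (q s) = q' s * D s\<close> with \<open>q' s\<close> invertible.\<close>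
lemma D_eq_0_if_finite_spectrum:
  assumes semisimple: "radical \<subseteq> {0}" and s: "s \<in> B" and fin: "finite (spectrum s)"
  shows "D s = 0"
proof -
  define A where "A = insert 0 (spectrum s)"
  define q where "q = (\<Prod>a\<in>A. [:- a, 1:])"
  have A: "finite A" "spectrum s \<subseteq> A"
    using fin by (auto simp: A_def)
  have "poly q r = 0" if "r \<in> A" for r
    using that A(1) by (auto simp: q_def poly_prod)
  then have "spectrum (peval q s) \<subseteq> {0}"
    using A(2) by (intro spectrum_peval_subset[OF s, of q 0 0]) (auto simp: A_def)
  then have "peval q s = 0"
    using s semisimple quasinilpotent_in_radical[of "peval q s"]
      quasinilpotent_if_spectrum_trivial[of "peval q s"] by auto
  then have product_0: "peval (pderiv q) s * D s = 0"
    using D_peval[OF s, of q] by simp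
  have pderiv_nz: "poly (pderiv q) r \<noteq> 0" if "r \<in> A" for r
    using A(1) that unfolding q_def by (rule poly_pderiv_prod_linear_nonzero)
  have "pderiv q \<noteq> 0"
    using pderiv_nz[of 0] by (auto simp: A_def)
  then have "has_inverse (peval (pderiv q) s)"
    using pderiv_nz A(2) by (intro has_inverse_peval[OF s]) auto
  then show ?thesis
    by (rule eq_0_if_has_inverse_mult_eq_0) (use product_0 s in simp_all)
qed

lemma separating_space_trivial:
  assumes semisimple: "radical \<subseteq> {0}" and s: "s \<in> separating_space"
  shows "s = 0"
proof -
  have D_0: "D t = 0" if "t \<in> separating_space" for t
    using semisimple separating_space_closed[OF that] finite_spectrum_if_separating[OF that]
    by (rule D_eq_0_if_finite_spectrum)
  have sB: "s \<in> B"
    using s by (rule separating_space_closed)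
  obtain f where f: "\<And>n. f n \<in> B" "(\<lambda>n. D (f n)) \<longlonglongrightarrow> s"
    using s by (auto simp: separating_space_def)
  have "D (f n) * s = 0" for n
    using D_mult[OF f(1) sB] D_0[OF s] D_0[OF separating_space_mult[OF f(1) s]] by simp
  moreover have "(\<lambda>n. D (f n) * s) \<longlonglongrightarrow> s * s"
    using f by (intro tendsto_intros)
  ultimately have "s * s = 0"
    by (simp add: LIMSEQ_const_iff)
  then show ?thesis
    using quasinilpotent_in_radical[OF sB quasinilpotent_if_square_zero] semisimple by auto
qed

theorem johnson:
  assumes "radical \<subseteq> {0}"
  shows "\<exists>M. \<forall>x\<in>B. norm (D x) \<le> M * norm x"
proof (rule closed_graph_bounded[OF subspace closed linear_on_D])
  fix x y assume "\<And>n. x n \<in> B" "x \<longlonglongrightarrow> 0" "(\<lambda>n. D (x n)) \<longlonglongrightarrow> y"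
  then have "y \<in> separating_space"
    unfolding separating_space_def by blast
  with assms show "y = 0"
    by (rule separating_space_trivial)
qed

lemma D_pow_closed: "y \<in> B \<Longrightarrow> (D ^^ n) y \<in> B"
  by (induction n) simp_all

lemma norm_D_pow_le:
  assumes D: "\<And>x. x \<in> B \<Longrightarrow> norm (D x) \<le> M * norm x" and "M \<ge> 0" and y: "y \<in> B"
  shows "norm ((D ^^ n) y) \<le> M ^ n * norm y"
proof (induction n)
  case (Suc n)
  have "norm ((D ^^ Suc n) y) \<le> M * norm ((D ^^ n) y)"
    using D[OF D_pow_closed[OF y]] by simp
  also have "\<dots> \<le> M * (M ^ n * norm y)"
    using Suc \<open>M \<ge> 0\<close> by (rule mult_left_mono)
  finally show ?case by (simp add: mult.assoc)
qed simp

text \<open>The Leibniz rule for \<open>ad a\<close>, which maps \<open>D\<close> to the multiplication by \<open>D a\<close> and the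
  latter to zero.\<close>
lemma ad_pow_D_comp:
  assumes a: "a \<in> B" and T: "\<And>y. y \<in> B \<Longrightarrow> T y \<in> B" and y: "y \<in> B"
  shows "(ad a ^^ m) (D \<circ> T) y =
    D ((ad a ^^ m) T y) + real m *\<^sub>R (D a * (ad a ^^ (m - 1)) T y)"
  using y
proof (induction m arbitrary: y)
  case (Suc m)
  let ?E = "(ad a ^^ m) T" and ?E' = "(ad a ^^ (m - 1)) T"
  have E: "?E y \<in> B" "?E (a * y) \<in> B" and E': "?E' y \<in> B" "?E' (a * y) \<in> B"
    using ad_pow_closed[OF a T] a Suc.prems by simp_all
  have m: "real m *\<^sub>R (?E' (a * y) - a * ?E' y) = real m *\<^sub>R ?E y"
    by (cases m) (simp_all add: ad_pow_Suc del: funpow.simps)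
  have "(ad a ^^ Suc m) (D \<circ> T) y =
      D (?E (a * y)) + real m *\<^sub>R (D a * ?E' (a * y)) - a * (D (?E y) + real m *\<^sub>R (D a * ?E' y))"
    unfolding ad_pow_Suc using a Suc.prems by (simp only: Suc.IH mult_closed)
  also have "\<dots> = D (?E (a * y)) - a * D (?E y) + D a * (real m *\<^sub>R (?E' (a * y) - a * ?E' y))"
    using a E' by (simp add: algebra_simps mult_left_commute[of a "D a"])
  also have "\<dots> = D (?E (a * y) - a * ?E y) + D a * ?E y + D a * (real m *\<^sub>R ?E y)"
    unfolding m using a E by (simp add: D_diff D_mult)
  also have "\<dots> = D (?E (a * y) - a * ?E y) + real (Suc m) *\<^sub>R (D a * ?E y)"
    by (simp add: scaleR_add_left)
  finally show ?case
    unfolding ad_pow_Suc by simp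
qed simp

lemma ad_pow_D_pow:
  assumes a: "a \<in> B" and y: "y \<in> B"
  shows "(ad a ^^ n) (D ^^ n) y = fact n *\<^sub>R (epow (D a) n * y)"
  using y
proof (induction n arbitrary: y)
  case (Suc n)
  have "(ad a ^^ Suc n) (D ^^ n) y = 0"
    unfolding ad_pow_Suc using Suc a by (simp add: mult_left_commute[of a])
  moreover have "(ad a ^^ n) (D ^^ n) y = fact n *\<^sub>R (epow (D a) n * y)"
    using Suc by simp
  ultimately show ?case
    using ad_pow_D_comp[where T = "D ^^ n" and m = "Suc n", OF a D_pow_closed Suc.prems]
    by (simp only: funpow.simps(2)[of n D]) (simp add: mult.assoc)
qed simp

lemma norm_epow_D_le:
  assumes a: "a \<in> B" and D: "\<And>x. x \<in> B \<Longrightarrow> norm (D x) \<le> M * norm x" and "M \<ge> 0"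
  shows "norm (epow (D a) n) \<le> (2 * norm a * M) ^ n / fact n * norm e"
proof -
  have "fact n * norm (epow (D a) n) = norm ((ad a ^^ n) (D ^^ n) e)"
    using a by (simp add: ad_pow_D_pow)
  also have "\<dots> \<le> (2 * norm a) ^ n * M ^ n * norm e"
    using a norm_D_pow_le[OF D \<open>M \<ge> 0\<close>] \<open>M \<ge> 0\<close> by (intro norm_ad_pow_le) simp_all
  finally show ?thesis
    by (simp add: field_simps power_mult_distrib)
qed

theorem singer_wermer:
  assumes a: "a \<in> B" and bounded: "\<exists>M. \<forall>x\<in>B. norm (D x) \<le> M * norm x"
  shows "D a \<in> radical"
proof (rule quasinilpotent_in_radical)
  obtain M\<^sub>0 where M\<^sub>0: "\<And>x. x \<in> B \<Longrightarrow> norm (D x) \<le> M\<^sub>0 * norm x"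
    using bounded by blast
  define M where "M = \<bar>M\<^sub>0\<bar>"
  have M: "norm (D x) \<le> M * norm x" if "x \<in> B" for x
    unfolding M_def by (rule order_trans[OF M\<^sub>0[OF that]]) (simp add: mult_right_mono)
  have "epow (r *\<^sub>R D a) \<longlonglongrightarrow> 0" if "r \<ge> 0" for r
  proof (rule Lim_null_comparison)
    show "(\<lambda>n. (r * (2 * norm a * M)) ^ n / fact n * norm e) \<longlonglongrightarrow> 0"
      using summable_LIMSEQ_zero[OF summable_exp[of "r * (2 * norm a * M)"]]
      by (intro tendsto_mult_left_zero) (simp add: field_simps)
    have "norm (epow (r *\<^sub>R D a) n) \<le> (r * (2 * norm a * M)) ^ n / fact n * norm e" for n
    proof -
      have "norm (epow (r *\<^sub>R D a) n) = r ^ n * norm (epow (D a) n)"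
        using that by (simp add: epow_scaleR)
      also have "\<dots> \<le> r ^ n * ((2 * norm a * M) ^ n / fact n * norm e)"
        using a M that by (intro mult_left_mono norm_epow_D_le) (simp_all add: M_def)
      finally show ?thesis
        by (simp add: power_mult_distrib mult_ac)
    qed
    then show "\<forall>\<^sub>F n in sequentially.
        norm (epow (r *\<^sub>R D a) n) \<le> (r * (2 * norm a * M)) ^ n / fact n * norm e"
      by simp
  qed
  then show "quasinilpotent (D a)"
    by (simp add: quasinilpotent_def)
qed (simp add: a)

corollary D_eq_0_if_semisimple: "radical \<subseteq> {0} \<Longrightarrow> a \<in> B \<Longrightarrow> D a = 0"
  using singer_wermer johnson by blast

end

section \<open>Banach algebras with a right unit\<close>

definition corner :: "'a::ring \<Rightarrow> 'a set" where
  "corner e = {x. e * x = x}"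

locale right_unital_commutative_mod_rann =
  fixes e :: "'a::complex_banach_algebra"
  assumes right_unit [simp]: "x * e = x"
    and comm_mod_rann: "x * y - y * x \<in> rann"
begin

lemma mult_right_factors_commute: "z * (x * y) = z * (y * x)" for z :: 'a
  using comm_mod_rann[of x y] by (auto simp: rann_def right_diff_distrib)

lemma mult_unit_mult [simp]: "x * (e * y) = x * y"
  by (simp flip: mult.assoc)

lemma unit_mult_in_corner: "e * x \<in> corner e"
  by (simp add: corner_def)

lemma minus_unit_mult_in_rann: "x - e * x \<in> rann"
  by (simp add: rann_def right_diff_distrib)

sublocale corner: comm_banach_subalgebra "corner e" e
proof
  show "closed (corner e)"
    unfolding corner_def by (intro closed_Collect_eq continuous_intros)
  show "x * y = y * x" if "x \<in> corner e" "y \<in> corner e" for x y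
    using that mult_right_factors_commute[of e x y] by (simp add: corner_def flip: mult.assoc)
qed (simp_all add: corner_def distrib_left mult_scaleC_right flip: mult.assoc)

text \<open>If \<open>w\<close> inverts \<open>e - e * (a * x)\<close> in the corner, then \<open>- (a * x * w)\<close> is the
  quasi-inverse of \<open>a * x\<close>.\<close>
lemma radical_subset_jac_rad: "corner.radical \<subseteq> jac_rad"
  unfolding jac_rad_def
proof safe
  fix x a assume "x \<in> corner.radical"
  then have "corner.has_inverse (e - (e * a) * x)"
    using unit_mult_in_corner[of a] by (simp add: corner.radical_def)
  then obtain w where w: "(e - e * (a * x)) * w = e"
    by (auto simp: corner.has_inverse_def mult.assoc)
  define z where "z = a * x"
  have "z = z * ((e - e * z) * w)"
    using w by (simp add: z_def)
  also have "\<dots> = z * w - z * (z * w)"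
    by (simp add: left_diff_distrib right_diff_distrib mult.assoc)
  finally have z: "z - z * w + z * (z * w) = 0"
    by (simp add: algebra_simps)
  have "z * w * z = z * (z * w)"
    by (simp add: mult.assoc mult_right_factors_commute[of z w])
  with z have "z + - (z * w) - z * - (z * w) = 0 \<and> z + - (z * w) - - (z * w) * z = 0"
    by simp
  then show "quasi_invertible (a * x)"
    unfolding quasi_invertible_def z_def by blast
qed

end

context
  fixes d :: "'a::complex_banach_algebra \<Rightarrow> 'a"
  assumes d: "derivation d"
begin

lemma derivation_add: "d (x + y) = d x + d y"
  and derivation_scaleC: "d (scaleC c x) = scaleC c (d x)"
  and derivation_mult: "d (x * y) = d x * y + x * d y"
  using d by (simp_all add: derivation_def)

lemma derivation_rann: "r \<in> rann \<Longrightarrow> d r \<in> rann"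
  using derivation_mult[of _ r] derivation_add[of 0 0] by (simp add: rann_def)

lemma subalgebra_derivation_corner:
  fixes e :: 'a
  assumes e: "right_unital_commutative_mod_rann e"
  shows "subalgebra_derivation (corner e) e (\<lambda>x. e * d x)"
proof -
  interpret right_unital_commutative_mod_rann e
    by (rule e)
  show ?thesis
  proof unfold_locales
    fix x y assume "x \<in> corner e" "y \<in> corner e"
    then have "e * (x * d y) = x * (e * d y)"
      by (metis corner.unit_mult mult.assoc right_unit)
    then show "e * d (x * y) = e * d x * y + x * (e * d y)"
      by (simp add: derivation_mult distrib_left mult.assoc)
  qed (simp_all add: unit_mult_in_corner derivation_add derivation_scaleC distrib_left
      mult_scaleC_right)
qed

lemma derivation_into_rann:
  fixes e :: 'a
  assumes rad: "(jac_rad :: 'a set) = rann" and e: "right_unital_commutative_mod_rann e"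
  shows "d x \<in> rann"
proof -
  interpret right_unital_commutative_mod_rann e
    by (rule e)
  interpret subalgebra_derivation "corner e" e "\<lambda>x. e * d x"
    using e by (rule subalgebra_derivation_corner)
  have "x = 0" if "x \<in> corner.radical" for x
  proof -
    have "x \<in> corner e" "x \<in> rann"
      using that radical_subset_jac_rad rad by (auto simp: corner.radical_def)
    then show ?thesis
      using corner.unit_mult[of x] by (simp add: rann_def)
  qed
  then have "corner.radical \<subseteq> {0}"
    by blast
  then have "e * d (e * x) = 0"
    using unit_mult_in_corner by (rule D_eq_0_if_semisimple)
  moreover have "e * d (x - e * x) = 0"
    using derivation_rann[OF minus_unit_mult_in_rann] by (simp add: rann_def)
  ultimately have "e * d x = 0"
    using derivation_add[of "x - e * x" "e * x"] by (simp add: distrib_left)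
  then have "a * d x = 0" for a
    using mult_unit_mult[of a "d x"] by simp
  then show ?thesis by (simp add: rann_def)
qed

lemma derivation_idempotent_mult_eq_0:
  assumes into_rann: "\<And>x. d x \<in> rann" and "k_commuting k d" "k \<ge> 1" and "a * a = a"
  shows "d a * a = 0"
proof -
  have "npow a k = a"
    using \<open>k \<ge> 1\<close> \<open>a * a = a\<close> by (induction a k rule: npow.induct) auto
  then have "commutator (d a) a = 0"
    using \<open>k_commuting k d\<close> by (metis k_commuting_def)
  then show ?thesis
    using into_rann[of a] by (simp add: commutator_def rann_def)
qed

text \<open>The idempotents \<open>e\<close> and \<open>e + r\<close> with \<open>r\<close> in \<open>rann\<close> suffice as test elements.\<close>
lemma k_commuting_derivation_eq_0:
  fixes e :: 'a
  assumes e: "\<And>a::'a. a * e = a" and into_rann: "\<And>x. d x \<in> rann"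
    and k: "k_commuting k d" "k \<ge> 1"
  shows "d = (\<lambda>_. 0)"
proof
  fix x
  note idempotent = derivation_idempotent_mult_eq_0[OF into_rann k]
  have d_e: "d e = 0"
    using idempotent[of e] by (simp add: e)
  define r where "r = x - e * x"
  have r: "b * r = 0" for b
    by (simp add: r_def right_diff_distrib e flip: mult.assoc)
  have "(e + r) * (e + r) = e + r"
    by (simp add: r e distrib_left)
  then have "d (e + r) * (e + r) = 0"
    by (rule idempotent)
  then have "d r = 0"
    by (simp add: r e distrib_left derivation_add d_e)
  moreover have "d (e * x) = 0"
    using into_rann[of x] by (simp add: derivation_mult d_e rann_def)
  ultimately show "d x = 0"
    using derivation_add[of r "e * x"] by (simp add: r_def)
qed

end

lemma alg_center_inter_rann:
  fixes e z :: "'a::ring"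
  assumes e: "\<And>a::'a. a * e = a" and "z \<in> alg_center" "z \<in> rann"
  shows "z = 0"
proof -
  have "z = z * e" by (simp add: e)
  also have "\<dots> = e * z"
    using assms(2) by (simp add: alg_center_def)
  finally show ?thesis
    using assms(3) by (simp add: rann_def)
qed

theorem theorem4p1:
  fixes d :: "'a::complex_banach_algebra \<Rightarrow> 'a" and k :: nat
  assumes "(jac_rad :: 'a set) = rann"
    and "\<forall>a b :: 'a. a * b - b * a \<in> jac_rad"
    and "\<exists>e :: 'a. \<forall>a. a * e = a"
    and "derivation d"
    and "k \<ge> 1"
  shows "(d = (\<lambda>_. 0) \<longleftrightarrow> k_centralizing k d) \<and> (k_centralizing k d \<longleftrightarrow> k_commuting k d)"
proof -
  obtain e :: 'a where e: "\<And>a. a * e = a"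
    using assms(3) by blast
  have commutator_in_rann: "commutator a b \<in> rann" for a b :: 'a
    using assms(1,2) by (simp add: commutator_def)
  then have "right_unital_commutative_mod_rann e"
    by unfold_locales (simp_all add: e commutator_def)
  with assms(1,4) have "d x \<in> rann" for x
    using derivation_into_rann by blast
  then have "d = (\<lambda>_. 0)" if "k_commuting k d"
    using k_commuting_derivation_eq_0[OF assms(4) e _ that assms(5)] by blast
  moreover have "k_commuting k d" if "k_centralizing k d"
    using that alg_center_inter_rann[OF e _ commutator_in_rann]
    by (simp add: k_centralizing_def k_commuting_def)
  moreover have "k_centralizing k d" if "d = (\<lambda>_. 0)"
    using that by (simp add: k_centralizing_def commutator_def alg_center_def)
  ultimately show ?thesis by blast
qed

end
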